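(* Let $n\ge 1$ be an integer, let $p\ge 1$ and $s > 0$, and let $f, g : \mathbb{R}^n \rightarrow [0,\infty)$ be (Lebesgue) integrable functions with nonempty support such that $$\tilde{\mathcal{S}}_{p,s}(f ; g)=\frac{p}{n+s} \lim _{\varepsilon \rightarrow 0^{+}} \frac{\int_{\mathbb{R}^n} \left[f \oplus_{p,s}\left(\varepsilon \times_{p,s} g\right)\right]-\int_{\mathbb{R}^n} f}{\varepsilon}$$ exists. Then $$\tilde{\mathcal{S}}_{p,s}(f ; g) \geq\left(\int_{\mathbb{R}^n} f\right)^{1-\frac{p}{n+s}}\left(\int_{\mathbb{R}^n} g\right)^{\frac{p}{n+s}}.$$ Moreover, if $s$ is an integer, $f = \lambda \times_{p,s} g$ for some $\lambda> 0$, and $g$ is $s$-concave such that $\operatorname{supp} g$ has nonempty interior and contains the origin, then equality holds in this inequality.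
   Context: Integrals are with respect to Lebesgue measure on $\mathbb{R}^n$. For a nonnegative function $f$ on $\mathbb{R}^n$, $\operatorname{supp} f$ denotes the closure of $\{x\in\mathbb{R}^n: f(x)>0\}$. For $p\ge1$, let $q$ be its Hölder conjugate, $\frac1p+\frac1q=1$; when $p=1$, $q=\infty$ and $1/q$ is defined as $0$, so that $(1-\lambda)^{1/q}=\lambda^{1/q}=1$ for all $\lambda\in[0,1]$ (convention $0^0=1$). For sets $K,L\subset\mathbb{R}^n$, $K+_pL=\{(1-\lambda)^{1/q}x+\lambda^{1/q}y: x\in K,\ y\in L,\ 0\le\lambda\le1\}$. For $s>0$ and functions $f,g:\mathbb{R}^n\to[0,\infty)$ with nonempty supports, the function $f\oplus_{p,s}g$ is defined by $$[f \oplus_{p,s} g](z)=\sup \Big\{\big((1-\lambda)^{\frac{1}{q}}f(x)^{\frac{1}{s}}+\lambda^{\frac{1}{q}}g(y)^{\frac{1}{s}}\big)^s: x \in \operatorname{supp}f,\ y \in \operatorname{supp}g,\ \lambda\in[0,1],\ z=(1-\lambda)^{\frac{1}{q}}x+\lambda^{\frac{1}{q}}y\Big\}$$ when $z\in \operatorname{supp}f+_p\operatorname{supp}g$, and $[f \oplus_{p,s} g](z)=0$ otherwise. For $\lambda>0$, the function $\lambda\times_{p,s}f:\mathbb{R}^n\to[0,\infty)$ is defined by $[\lambda\times_{p,s}f](x)=\lambda^{\frac{s}{p}}f(\lambda^{-\frac1p}x)$. The quantity $\tilde{\mathcal{S}}_{p,s}(f;g)$ is said to exist when the integrals in its definition are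 defined and the limit exists. For $0<s<\infty$, a function $f:\mathbb{R}^n\to[0,\infty)$ is $s$-concave if $\operatorname{supp} f$ is nonempty, compact and convex, and $f^{1/s}$ is concave on $\operatorname{supp} f$, i.e. $f(\lambda x+(1-\lambda)y)\ge\big[\lambda f(x)^{1/s}+(1-\lambda)f(y)^{1/s}\big]^s$ for all $x,y\in\operatorname{supp}f$ and $0\le\lambda\le1$. *)

theory Defs
  imports "HOL-Analysis.Analysis"
begin

definition fsupp :: "('a::topological_space \<Rightarrow> real) \<Rightarrow> 'a set" where
  "fsupp f = closure {x. f x > 0}"

text \<open>Power of a nonnegative real with the convention \<open>0\<^sup>0 = 1\<close>
  (whereas \<open>0 powr 0 = 0\<close> in the library).\<close>

definition pow0 :: "real \<Rightarrow> real \<Rightarrow> real" where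
  "pow0 x a = (if a = 0 then 1 else x powr a)"

text \<open>The extended version takes the value \<open>\<infinity>\<close> on \<open>0\<close> raised to a negative exponent.\<close>

definition epow :: "real \<Rightarrow> real \<Rightarrow> ereal" where
  "epow x a = (if x = 0 \<and> a < 0 then \<infinity> else ereal (pow0 x a))"

text \<open>\<open>lp_coeff p t\<close> is \<open>t\<close> to the power \<open>1/q = 1 - 1/p\<close>,
  where \<open>q\<close> is the Hoelder conjugate of \<open>p\<close>; it is constantly \<open>1\<close> for \<open>p = 1\<close>.\<close>

definition lp_coeff :: "real \<Rightarrow> real \<Rightarrow> real" where
  "lp_coeff p t = pow0 t (1 - 1 / p)"

definition lp_sum :: "real \<Rightarrow> 'a::real_vector set \<Rightarrow> 'a set \<Rightarrow> 'a set" where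
  "lp_sum p K L = {lp_coeff p (1 - t) *\<^sub>R x + lp_coeff p t *\<^sub>R y | x y t.
                     x \<in> K \<and> y \<in> L \<and> 0 \<le> t \<and> t \<le> 1}"

text \<open>The supremum may be infinite when \<open>f\<close> or \<open>g\<close> is unbounded, hence the codomain.\<close>

definition lps_sup_conv ::
  "real \<Rightarrow> real \<Rightarrow> ('a::real_normed_vector \<Rightarrow> real) \<Rightarrow> ('a \<Rightarrow> real) \<Rightarrow> 'a \<Rightarrow> ennreal" where
  "lps_sup_conv p s f g z =
     (if z \<in> lp_sum p (fsupp f) (fsupp g) then
        Sup {ennreal ((lp_coeff p (1 - t) * f x powr (1 / s)
                       + lp_coeff p t * g y powr (1 / s)) powr s) | x y t.
              x \<in> fsupp f \<and> y \<in> fsupp g \<and> 0 \<le> t \<and> t \<le> 1 \<and>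
              z = lp_coeff p (1 - t) *\<^sub>R x + lp_coeff p t *\<^sub>R y}
      else 0)"

definition lps_scale ::
  "real \<Rightarrow> real \<Rightarrow> real \<Rightarrow> ('a::real_vector \<Rightarrow> real) \<Rightarrow> 'a \<Rightarrow> real" where
  "lps_scale p s l f x = l powr (s / p) * f (l powr (- 1 / p) *\<^sub>R x)"

definition s_concave :: "real \<Rightarrow> ('a::real_normed_vector \<Rightarrow> real) \<Rightarrow> bool" where
  "s_concave s f \<longleftrightarrow>
     fsupp f \<noteq> {} \<and> compact (fsupp f) \<and> convex (fsupp f) \<and>
     concave_on (fsupp f) (\<lambda>x. f x powr (1 / s))"

text \<open>For integrable \<open>f\<close> the numerator below is never of the form \<open>\<infinity> - \<infinity>\<close>.\<close>

definition lps_quotient ::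
  "real \<Rightarrow> real \<Rightarrow> (real^'n \<Rightarrow> real) \<Rightarrow> (real^'n \<Rightarrow> real) \<Rightarrow> real \<Rightarrow> ereal" where
  "lps_quotient p s f g e =
     (enn2ereal (\<integral>\<^sup>+ z. lps_sup_conv p s f (lps_scale p s e g) z \<partial>lebesgue)
        - ereal (integral\<^sup>L lebesgue f)) / ereal e"

text \<open>The integral of a nonnegative extended function is defined as soon as the function is
  Lebesgue measurable, and may be infinite; the limit is taken in the extended reals,
  so that it exists in particular when it exists as a real number.\<close>

definition S_tilde_exists ::
  "real \<Rightarrow> real \<Rightarrow> (real^'n \<Rightarrow> real) \<Rightarrow> (real^'n \<Rightarrow> real) \<Rightarrow> bool" where
  "S_tilde_exists p s f g \<longleftrightarrow>
     (\<forall>\<^sub>F e in at_right 0. lps_sup_conv p s f (lps_scale p s e g) \<in> borel_measurable lebesgue) \<and>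
     (\<exists>L. (lps_quotient p s f g \<longlongrightarrow> L) (at_right 0))"

definition S_tilde ::
  "real \<Rightarrow> real \<Rightarrow> (real^'n \<Rightarrow> real) \<Rightarrow> (real^'n \<Rightarrow> real) \<Rightarrow> ereal" where
  "S_tilde p s f g =
     ereal (p / (real CARD('n) + s)) * Lim (at_right 0) (lps_quotient p s f g)"

end

theory Submission
  imports Defs
begin

text \<open>
  With \<open>n\<close> the dimension, \<open>r = (n + s) / p\<close>, \<open>A = \<integral>f\<close> and \<open>B = \<integral>g\<close>, the inequality is the derivative at \<open>e = 0\<close>
  of the \<open>L\<^sub>p\<close> Borell--Brascamp--Lieb inequality (\<open>nn_integral_lps_sup_conv_ge\<close>)
    \<open>\<integral> f \<oplus> (e \<times> g) \<ge> (A\<^sup>1\<^sup>/\<^sup>r + e B\<^sup>1\<^sup>/\<^sup>r)\<^sup>r\<close>.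
  The two sides agree at \<open>e = 0\<close>, where the left one is read as \<open>A\<close>, so the difference quotients are ordered
  (\<open>lps_quotient_ge\<close>), and the right-hand one converges to \<open>r A\<^sup>1\<^sup>-\<^sup>1\<^sup>/\<^sup>r B\<^sup>1\<^sup>/\<^sup>r\<close> (\<open>tendsto_lower_bound_epow\<close>,
  which also covers \<open>A = 0\<close>). The factor \<open>1 / r\<close> in \<open>S_tilde\<close> cancels the \<open>r\<close>.

  The \<open>L\<^sub>p\<close> inequality follows from its additive version (\<open>borell_brascamp_lieb\<close>): if
  \<open>h(x + y) \<ge> (f(x)\<^sup>1\<^sup>/\<^sup>s + g(y)\<^sup>1\<^sup>/\<^sup>s)\<^sup>s\<close> wherever \<open>f(x)\<close> and \<open>g(y)\<close> are positive, and \<open>A\<close> and \<open>B\<close> are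
  positive, then \<open>\<integral>h\<close> is at least the same expression in \<open>A\<close> and \<open>B\<close> with \<open>n + s\<close> in place of \<open>s\<close>.
  Fixing the parameter \<open>t\<close> in the definition of the convolution
  and dilating \<open>f\<close> and \<open>g\<close> by the two coefficients gives the additive situation, and the best \<open>t\<close>
  gives an \<open>l\<^sub>p\<close> sum (\<open>lp_optimal_parameter\<close>).

  The additive inequality is stable under Fubini's theorem: integrating out one coordinate raises \<open>s\<close> by
  one. Induction on the dimension (\<open>borell_brascamp_lieb_PiM\<close>) therefore reduces it to the line, where it
  follows from the Brunn--Minkowski inequality for level sets of \<open>f\<close> and \<open>g\<close> scaled to have supremum one
  (\<open>nn_integral_sum_le_of_min\<close>), together with Hoelder's inequality (\<open>psum_le_weighted\<close>).

  For equality, the dilates of an \<open>s\<close>-concave \<open>g\<close> whose support contains the origin satisfy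
    \<open>(l \<times> g) \<oplus> (e \<times> g) \<le> (l + e) \<times> g\<close>
  pointwise (\<open>lps_sup_conv_scale_le\<close>), so that the difference quotient is at most
  \<open>((l + e)\<^sup>r - l\<^sup>r) / e * B\<close>. The limit of this bound is \<open>r l\<^sup>r\<^sup>-\<^sup>1 B\<close>, which agrees with the lower bound because
  \<open>A = l\<^sup>r B\<close>.
\<close>

section \<open>The Brunn--Minkowski inequality on the line\<close>

text \<open>
  For points \<open>x\<close> of \<open>A\<close> and \<open>y\<close> of \<open>B\<close>, the translates \<open>y + (A \<inter> {..x})\<close> and \<open>x + (B \<inter> {y<..})\<close> both lie
  in \<open>A + B\<close>, on opposite sides of \<open>x + y\<close>, so their measures add up. Choosing \<open>x\<close> near \<open>Sup A\<close> and
  \<open>y\<close> near \<open>Inf B\<close> loses arbitrarily little of \<open>A\<close> and \<open>B\<close>. The set \<open>C\<close> stands in for \<open>A + B\<close>,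
  which need not be measurable.
\<close>

lemma brunn_minkowski_real_bounded:
  fixes A B C :: "real set"
  assumes [measurable]: "A \<in> sets borel" "B \<in> sets borel" "C \<in> sets borel"
    and ne: "A \<noteq> {}" "B \<noteq> {}" and bdd: "bdd_above A" "bdd_below B"
    and sum: "\<And>x y. x \<in> A \<Longrightarrow> y \<in> B \<Longrightarrow> x + y \<in> C"
  shows "emeasure lborel A + emeasure lborel B \<le> emeasure lborel C"
proof (rule ennreal_le_epsilon)
  fix e :: real
  assume "e > 0"
  obtain x where x: "x \<in> A" "Sup A - e / 2 < x"
    using less_cSupD[OF ne(1), of "Sup A - e / 2"] \<open>e > 0\<close> by auto
  obtain y where y: "y \<in> B" "y < Inf B + e / 2"
    using cInf_lessD[OF ne(2), of "Inf B + e / 2"] \<open>e > 0\<close> by auto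
  let ?A = "(\<lambda>a. y + a) ` (A \<inter> {..x})" and ?B = "(\<lambda>b. x + b) ` (B \<inter> {y<..})"
  have shift: "S \<in> sets borel \<Longrightarrow> (\<lambda>a. c + a) ` S \<in> sets borel \<and>
    emeasure lborel ((\<lambda>a. c + a) ` S) = emeasure lborel S" for c :: real and S
  proof -
    assume S [measurable]: "S \<in> sets borel"
    have eq: "(\<lambda>a. c + a) ` S = (\<lambda>a. - c + a) -` S"
      by (auto simp: image_iff intro!: bexI[where x="_ - c"])
    have "emeasure lborel S = emeasure (distr lborel borel (\<lambda>a. - c + a)) S"
      by (simp only: lborel_distr_plus)
    also have "\<dots> = emeasure lborel ((\<lambda>a. c + a) ` S)"
      unfolding eq by (subst emeasure_distr) auto
    finally show ?thesis
      unfolding eq by (auto intro!: measurable_sets_borel[OF _ S])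
  qed
  have "A \<subseteq> (A \<inter> {..x}) \<union> {Sup A - e/2 .. Sup A}"
    using x cSup_upper[OF _ bdd(1)] by (auto simp: not_le)
  then have "emeasure lborel A \<le> emeasure lborel ((A \<inter> {..x}) \<union> {Sup A - e/2 .. Sup A})"
    by (intro emeasure_mono) auto
  also have "\<dots> \<le> emeasure lborel (A \<inter> {..x}) + emeasure lborel {Sup A - e/2 .. Sup A}"
    by (intro emeasure_subadditive) auto
  finally have a: "emeasure lborel A \<le> emeasure lborel ?A + ennreal (e / 2)"
    using shift[of "A \<inter> {..x}" y] \<open>e > 0\<close> by simp
  have "B \<subseteq> (B \<inter> {y<..}) \<union> {Inf B .. Inf B + e/2}"
    using y cInf_lower[OF _ bdd(2)] by (force simp: not_less)
  then have "emeasure lborel B \<le> emeasure lborel ((B \<inter> {y<..}) \<union> {Inf B .. Inf B + e/2})"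
    by (intro emeasure_mono) auto
  also have "\<dots> \<le> emeasure lborel (B \<inter> {y<..}) + emeasure lborel {Inf B .. Inf B + e/2}"
    by (intro emeasure_subadditive) auto
  finally have b: "emeasure lborel B \<le> emeasure lborel ?B + ennreal (e / 2)"
    using shift[of "B \<inter> {y<..}" x] \<open>e > 0\<close> by simp
  have swap: "(p + q) + (r + q) = (p + r) + (q + q)" for p q r :: ennreal
    by (simp only: ac_simps)
  have disj: "emeasure lborel ?A + emeasure lborel ?B = emeasure lborel (?A \<union> ?B)"
    using shift[of "A \<inter> {..x}" y] shift[of "B \<inter> {y<..}" x]
    by (intro plus_emeasure) auto
  have incl: "emeasure lborel (?A \<union> ?B) \<le> emeasure lborel C"
    using x(1) y(1) sum by (intro emeasure_mono) (auto simp: add.commute[of y])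
  have "emeasure lborel A + emeasure lborel B
      \<le> (emeasure lborel ?A + ennreal (e / 2)) + (emeasure lborel ?B + ennreal (e / 2))"
    by (rule add_mono[OF a b])
  also have "\<dots> = emeasure lborel (?A \<union> ?B) + (ennreal (e / 2) + ennreal (e / 2))"
    unfolding disj[symmetric] by (rule swap)
  also have "\<dots> \<le> emeasure lborel C + (ennreal (e / 2) + ennreal (e / 2))"
    by (rule add_right_mono[OF incl])
  also have "ennreal (e / 2) + ennreal (e / 2) = ennreal e"
    using \<open>e > 0\<close> by (simp flip: ennreal_plus)
  finally show "emeasure lborel A + emeasure lborel B \<le> emeasure lborel C + ennreal e" .
qed

lemma brunn_minkowski_real:
  fixes A B C :: "real set"
  assumes [measurable]: "A \<in> sets borel" "B \<in> sets borel" "C \<in> sets borel"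
    and ne: "A \<noteq> {}" "B \<noteq> {}"
    and sum: "\<And>x y. x \<in> A \<Longrightarrow> y \<in> B \<Longrightarrow> x + y \<in> C"
  shows "emeasure lborel A + emeasure lborel B \<le> emeasure lborel C"
proof -
  obtain a b where ab: "a \<in> A" "b \<in> B"
    using ne by blast
  let ?A = "\<lambda>k::nat. A \<inter> {..a + real k}" and ?B = "\<lambda>k::nat. B \<inter> {b - real k..}"
  have "(\<lambda>k. emeasure lborel (?A k)) \<longlonglongrightarrow> emeasure lborel (\<Union>k. ?A k)"
    by (rule Lim_emeasure_incseq) (auto simp: incseq_def)
  moreover have "(\<Union>k. ?A k) = A"
    by (auto simp: real_arch_simple) (metis add.commute diff_le_eq real_arch_simple)
  moreover have "(\<lambda>k. emeasure lborel (?B k)) \<longlonglongrightarrow> emeasure lborel (\<Union>k. ?B k)"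
    by (rule Lim_emeasure_incseq) (auto simp: incseq_def)
  moreover have "(\<Union>k. ?B k) = B"
    by auto (metis add.commute diff_le_eq real_arch_simple)
  ultimately have "(\<lambda>k. emeasure lborel (?A k) + emeasure lborel (?B k))
      \<longlonglongrightarrow> emeasure lborel A + emeasure lborel B"
    by (intro tendsto_add) auto
  moreover have "\<And>k. emeasure lborel (?A k) + emeasure lborel (?B k) \<le> emeasure lborel C"
    using ab by (intro brunn_minkowski_real_bounded) (auto intro: sum)
  ultimately show ?thesis
    by (intro LIMSEQ_le_const2) auto
qed

section \<open>Superadditivity of the integral for normalised functions on the line\<close>

lemma nn_integral_layer_cake:
  fixes h :: "real \<Rightarrow> ennreal"
  assumes [measurable]: "h \<in> borel_measurable borel"
  shows "(\<integral>\<^sup>+x. h x \<partial>lborel)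
    = (\<integral>\<^sup>+u. indicator {0<..} u * emeasure lborel {x. ennreal u < h x} \<partial>lborel)"
proof -
  have pt: "h x = (\<integral>\<^sup>+u. indicator {u. 0 < u \<and> ennreal u < h x} u \<partial>lborel)" for x
  proof (cases "h x")
    case (real r)
    then have "{u. 0 < u \<and> ennreal u < h x} = {0<..<r}"
      by (auto simp: ennreal_less_iff)
    then show ?thesis
      using real by simp
  next
    case top
    then have "{u. 0 < u \<and> ennreal u < h x} = {0<..}"
      by auto
    moreover have "emeasure lborel {0::real<..} = \<infinity>"
    proof (rule ccontr)
      assume "emeasure lborel {0::real<..} \<noteq> \<infinity>"
      then obtain r where r: "r \<ge> 0" "emeasure lborel {0::real<..} = ennreal r"
        by (cases "emeasure lborel {0::real<..}") auto
      have "emeasure lborel {0<..<r + 1} \<le> emeasure lborel {0::real<..}"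
        by (intro emeasure_mono) auto
      with r show False
        by simp
    qed
    ultimately show ?thesis
      using top by simp
  qed
  have "(\<integral>\<^sup>+x. h x \<partial>lborel)
      = (\<integral>\<^sup>+x. (\<integral>\<^sup>+u. indicator {u. 0 < u \<and> ennreal u < h x} u \<partial>lborel) \<partial>lborel)"
    using pt by simp
  also have "\<dots> = (\<integral>\<^sup>+u. (\<integral>\<^sup>+x. indicator {u. 0 < u \<and> ennreal u < h x} u \<partial>lborel) \<partial>lborel)"
    by (rule lborel_pair.Fubini') measurable
  also have "\<dots> = (\<integral>\<^sup>+u. indicator {0<..} u * emeasure lborel {x. ennreal u < h x} \<partial>lborel)"
  proof (rule nn_integral_cong)
    fix u :: real
    have "(\<integral>\<^sup>+x. indicator {u. 0 < u \<and> ennreal u < h x} u \<partial>lborel)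
        = (\<integral>\<^sup>+x. indicator {0<..} u * indicator {x. ennreal u < h x} x \<partial>lborel)"
      by (intro nn_integral_cong) (auto simp: indicator_def)
    also have "\<dots> = indicator {0<..} u * emeasure lborel {x. ennreal u < h x}"
      by (subst nn_integral_cmult) auto
    finally show "(\<integral>\<^sup>+x. indicator {u. 0 < u \<and> ennreal u < h x} u \<partial>lborel) = \<dots>" .
  qed
  finally show ?thesis .
qed

text \<open>
  For \<open>u > 0\<close> the level sets satisfy \<open>{f > u} + {g > u} \<subseteq> {h > u}\<close>. For \<open>0 < u < 1\<close> both summands are nonempty,
  so the Brunn--Minkowski inequality applies to them; for \<open>u \<ge> 1\<close> they are empty. Integrating over the
  levels gives the claim. Equality of the two suprema is what makes the two families of level sets
  nonempty for exactly the same \<open>u\<close>.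
\<close>

lemma nn_integral_sum_le_of_min:
  fixes f g :: "real \<Rightarrow> real" and h :: "real \<Rightarrow> ennreal"
  assumes [measurable]: "f \<in> borel_measurable borel" "g \<in> borel_measurable borel"
      "h \<in> borel_measurable borel"
    and le1: "\<And>x. f x \<le> 1" "\<And>x. g x \<le> 1"
    and sup1: "\<And>u. u < 1 \<Longrightarrow> \<exists>x. u < f x" "\<And>u. u < 1 \<Longrightarrow> \<exists>x. u < g x"
    and min: "\<And>x y. 0 < f x \<Longrightarrow> 0 < g y \<Longrightarrow> ennreal (min (f x) (g y)) \<le> h (x + y)"
  shows "(\<integral>\<^sup>+x. ennreal (f x) \<partial>lborel) + (\<integral>\<^sup>+x. ennreal (g x) \<partial>lborel) \<le> (\<integral>\<^sup>+x. h x \<partial>lborel)"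
proof -
  let ?L = "\<lambda>h u. indicator {0<..} u * emeasure lborel {x. ennreal u < h x}"
  have [measurable]: "?L h \<in> borel_measurable borel"
    if [measurable]: "h \<in> borel_measurable borel" for h :: "real \<Rightarrow> ennreal"
  proof -
    have "Measurable.pred (borel \<Otimes>\<^sub>M lborel) (\<lambda>z. ennreal (fst z) < h (snd z))"
      by measurable
    then have "{z. ennreal (fst z) < h (snd z)} \<in> sets (borel \<Otimes>\<^sub>M lborel)"
      by (simp add: pred_def space_pair_measure)
    from lborel.measurable_emeasure_Pair[OF this]
    have "(\<lambda>u. emeasure lborel {x. ennreal u < h x}) \<in> borel_measurable borel"
      by (simp add: vimage_def)
    then show ?thesis
      by measurable
  qed
  have "?L (\<lambda>x. ennreal (f x)) u + ?L (\<lambda>x. ennreal (g x)) u \<le> ?L h u" for u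
  proof (cases "0 < u \<and> u < 1")
    case True
    have "emeasure lborel {x. ennreal u < ennreal (f x)}
        + emeasure lborel {x. ennreal u < ennreal (g x)} \<le> emeasure lborel {x. ennreal u < h x}"
    proof (rule brunn_minkowski_real)
      show "{x. ennreal u < ennreal (f x)} \<noteq> {}" "{x. ennreal u < ennreal (g x)} \<noteq> {}"
        using sup1(1)[of u] sup1(2)[of u] True by (auto simp: ennreal_less_iff)
      fix x y
      assume "x \<in> {x. ennreal u < ennreal (f x)}" "y \<in> {x. ennreal u < ennreal (g x)}"
      then have xy: "u < f x" "u < g y"
        using True by (auto simp: ennreal_less_iff)
      then have "ennreal u < ennreal (min (f x) (g y))"
        using True by (simp add: ennreal_less_iff)
      also have "\<dots> \<le> h (x + y)"
        using xy True by (intro min) auto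
      finally show "x + y \<in> {x. ennreal u < h x}"
        by simp
    qed measurable
    then show ?thesis
      using True by simp
  next
    case False
    then consider "u \<le> 0" | "u \<ge> 1" by linarith
    then show ?thesis
    proof cases
      case 2
      then have "f x \<le> u" "g x \<le> u" for x
        using le1[of x] by auto
      then show ?thesis
        using 2 by (simp add: ennreal_less_iff not_less[symmetric])
    qed simp
  qed
  then have "(\<integral>\<^sup>+u. ?L (\<lambda>x. ennreal (f x)) u + ?L (\<lambda>x. ennreal (g x)) u \<partial>lborel)
      \<le> (\<integral>\<^sup>+u. ?L h u \<partial>lborel)"
    by (intro nn_integral_mono)
  also have "(\<integral>\<^sup>+u. ?L (\<lambda>x. ennreal (f x)) u + ?L (\<lambda>x. ennreal (g x)) u \<partial>lborel)
      = (\<integral>\<^sup>+u. ?L (\<lambda>x. ennreal (f x)) u \<partial>lborel) + (\<integral>\<^sup>+u. ?L (\<lambda>x. ennreal (g x)) u \<partial>lborel)"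
    by (rule nn_integral_add) measurable
  finally show ?thesis
    by (simp only: nn_integral_layer_cake[symmetric] assms measurable_compose[OF _ measurable_ennreal])
qed

section \<open>The l^(1/r) combination of two numbers\<close>

text \<open>
  Hoelder's inequality for two summands and weights \<open>1 - t\<close>, \<open>t\<close>: after dividing by the right-hand side,
  Young's inequality bounds each summand, and the bounds add up to one.
\<close>

lemma holder_two_terms:
  fixes x1 x2 y1 y2 t :: real
  assumes "0 < t" "t < 1" "0 \<le> x1" "0 \<le> x2" "0 \<le> y1" "0 \<le> y2"
  shows "x1 powr (1 - t) * y1 powr t + x2 powr (1 - t) * y2 powr t
    \<le> (x1 + x2) powr (1 - t) * (y1 + y2) powr t"
proof (cases "x1 + x2 = 0 \<or> y1 + y2 = 0")
  case True
  then have "x1 = 0 \<and> x2 = 0 \<or> y1 = 0 \<and> y2 = 0"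
    using assms by linarith
  then show ?thesis by auto
next
  case False
  let ?S = "x1 + x2" and ?T = "y1 + y2"
  have pos: "?S > 0" "?T > 0"
    using False assms by auto
  have young: "x powr (1 - t) * y powr t
      \<le> ((1 - t) * (x / ?S) + t * (y / ?T)) * (?S powr (1 - t) * ?T powr t)"
    if "0 \<le> x" "0 \<le> y" for x y
  proof (cases "x = 0 \<or> y = 0")
    case True
    moreover have "0 \<le> ((1 - t) * (x / ?S) + t * (y / ?T)) * (?S powr (1 - t) * ?T powr t)"
      using that assms pos by (intro mult_nonneg_nonneg add_nonneg_nonneg) auto
    ultimately show ?thesis by auto
  next
    case False
    then have "(x / ?S) powr (1 - t) * (y / ?T) powr t \<le> (1 - t) * (x / ?S) + t * (y / ?T)"
      using that assms pos by (intro Youngs_inequality_0) auto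
    then show ?thesis
      using pos that by (simp add: powr_divide field_simps)
  qed
  have "x1 powr (1 - t) * y1 powr t + x2 powr (1 - t) * y2 powr t
      \<le> ((1 - t) * (x1 / ?S) + t * (y1 / ?T)) * (?S powr (1 - t) * ?T powr t)
        + ((1 - t) * (x2 / ?S) + t * (y2 / ?T)) * (?S powr (1 - t) * ?T powr t)"
    using assms by (intro add_mono young)
  also have "\<dots> = ((1 - t) * (x1 / ?S + x2 / ?S) + t * (y1 / ?T + y2 / ?T))
      * (?S powr (1 - t) * ?T powr t)"
    by (simp add: algebra_simps)
  also have "\<dots> = ?S powr (1 - t) * ?T powr t"
    using pos by (simp flip: add_divide_distrib)
  finally show ?thesis .
qed

text \<open>
  For nonnegative arguments this is the \<open>l\<^sup>1\<^sup>/\<^sup>r\<close> norm (a quasinorm if \<open>r > 1\<close>) of the pair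
  \<open>(a, b)\<close>. The Borell--Brascamp--Lieb inequality says that
  pointwise domination in terms of \<open>psum s\<close> implies domination of the integrals in terms of
  \<open>psum (n + s)\<close>.
\<close>

definition psum :: "real \<Rightarrow> real \<Rightarrow> real \<Rightarrow> real" where
  "psum r a b = (a powr (1 / r) + b powr (1 / r)) powr r"

lemma psum_nonneg: "0 \<le> psum r a b"
  by (simp add: psum_def)

lemma psum_mono:
  assumes "0 < r" "0 \<le> a" "a \<le> a'" "0 \<le> b" "b \<le> b'"
  shows "psum r a b \<le> psum r a' b'"
  using assms unfolding psum_def by (intro powr_mono2 add_mono) auto

lemma psum_mult:
  assumes "0 < r" "0 \<le> c" "0 \<le> a" "0 \<le> b"
  shows "psum r (c * a) (c * b) = c * psum r a b"
proof -
  have "(c * a) powr (1 / r) + (c * b) powr (1 / r)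
      = c powr (1 / r) * (a powr (1 / r) + b powr (1 / r))"
    using assms by (simp add: powr_mult algebra_simps)
  then show ?thesis
    using assms by (simp add: psum_def powr_mult powr_powr)
qed

lemma psum_zero [simp]:
  assumes "0 < r" "0 \<le> a"
  shows "psum r a 0 = a" "psum r 0 a = a"
  using assms by (simp_all add: psum_def powr_powr)

lemma psum_pos:
  assumes "0 < a" "0 < b"
  shows "0 < psum r a b"
proof -
  have "0 < a powr (1 / r) + b powr (1 / r)"
    using assms by (intro add_pos_pos) auto
  then show ?thesis
    by (simp add: psum_def)
qed

lemma tendsto_psum:
  assumes "0 < r" "(a \<longlongrightarrow> A) F" "(b \<longlongrightarrow> B) F"
    and "\<forall>\<^sub>F x in F. 0 \<le> a x" "\<forall>\<^sub>F x in F. 0 \<le> b x"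
  shows "((\<lambda>x. psum r (a x) (b x)) \<longlongrightarrow> psum r A B) F"
  unfolding psum_def using assms
  by (intro tendsto_powr' tendsto_add tendsto_const) (auto elim: eventually_mono)

text \<open>
  This is Hoelder's inequality with exponent \<open>1 / (1 + s)\<close>. It converts the estimate obtained after
  scaling \<open>f\<close> and \<open>g\<close> to supremum one, in which the suprema \<open>a\<close> and \<open>b\<close> still appear, into one that only
  depends on the integrals \<open>A\<close> and \<open>B\<close>.
\<close>

lemma psum_le_weighted:
  assumes "0 < s" "0 < a" "0 < b" "0 \<le> A" "0 \<le> B"
  shows "psum (1 + s) A B \<le> psum s a b * (A / a + B / b)"
proof -
  \<comment> \<open>With weights \<open>1 - t\<close> and \<open>t\<close>, the powers of \<open>a\<close> in the product of \<open>a powr (1 / s)\<close> and \<open>A / a\<close> cancel.\<close>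
  define t where "t = 1 / (1 + s)"
  have t: "0 < t" "t < 1" "1 - t = s * t" "t * (1 + s) = 1"
    using assms by (auto simp: t_def field_simps)
  have summand: "(c powr (1 / s)) powr (1 - t) * (C / c) powr t = C powr t"
    if "0 < c" "0 \<le> C" for c C
    using that assms by (simp add: t(3) powr_powr powr_divide)
  have "A powr t + B powr t
      \<le> (a powr (1 / s) + b powr (1 / s)) powr (1 - t) * (A / a + B / b) powr t"
    using holder_two_terms[OF t(1,2), of "a powr (1 / s)" "b powr (1 / s)" "A / a" "B / b"] assms
    by (simp add: summand)
  also have "\<dots> = (psum s a b * (A / a + B / b)) powr t"
    using assms by (simp add: psum_def powr_powr powr_mult t(3))
  finally have "(A powr t + B powr t) powr (1 + s)
      \<le> ((psum s a b * (A / a + B / b)) powr t) powr (1 + s)"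
    using assms by (intro powr_mono2) auto
  then show ?thesis
    using assms by (simp add: psum_def[of "1 + s"] powr_powr t(4) psum_nonneg flip: t_def)
qed

section \<open>The Borell--Brascamp--Lieb inequality\<close>

text \<open>
  Dividing \<open>f\<close> and \<open>g\<close> by their suprema \<open>a\<close> and \<open>b\<close>, and \<open>h\<close> by \<open>psum s a b\<close>, produces normalised functions:
  by homogeneity of \<open>psum s\<close>, the new \<open>h\<close> dominates the minimum of the new \<open>f\<close> and \<open>g\<close>.
\<close>

lemma borell_brascamp_lieb_real_bounded:
  fixes f g :: "real \<Rightarrow> real" and h :: "real \<Rightarrow> ennreal"
  assumes "0 < s"
    and [measurable]: "f \<in> borel_measurable borel" "g \<in> borel_measurable borel"
      "h \<in> borel_measurable borel"
    and nonneg: "\<And>x. 0 \<le> f x" "\<And>x. 0 \<le> g x"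
    and pos: "\<exists>x. 0 < f x" "\<exists>x. 0 < g x"
    and bdd: "bdd_above (range f)" "bdd_above (range g)"
    and int: "(\<integral>\<^sup>+x. ennreal (f x) \<partial>lborel) = ennreal A" "(\<integral>\<^sup>+x. ennreal (g x) \<partial>lborel) = ennreal B"
    and AB: "0 \<le> A" "0 \<le> B"
    and h: "\<And>x y. 0 < f x \<Longrightarrow> 0 < g y \<Longrightarrow> ennreal (psum s (f x) (g y)) \<le> h (x + y)"
  shows "ennreal (psum (1 + s) A B) \<le> (\<integral>\<^sup>+x. h x \<partial>lborel)"
proof -
  define a where "a = (SUP x. f x)"
  define b where "b = (SUP x. g x)"
  define M where "M = psum s a b"
  have le: "f x \<le> a" "g x \<le> b" for x
    unfolding a_def b_def using bdd by (auto intro: cSUP_upper)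
  have ab: "0 < a" "0 < b"
    using pos le by (meson less_le_trans)+
  then have M: "0 < M"
    by (simp add: M_def psum_pos)
  have normalised: "ennreal (min (f x / a) (g y / b)) \<le> ennreal (1 / M) * h (x + y)"
    if "0 < f x / a" "0 < g y / b" for x y
  proof -
    define m where "m = min (f x / a) (g y / b)"
    have m: "0 \<le> m" "m * a \<le> f x" "m * b \<le> g y"
      using that ab by (auto simp: m_def min_def field_simps)
    have "m * M = psum s (m * a) (m * b)"
      using ab m by (simp add: M_def psum_mult \<open>0 < s\<close>)
    also have "\<dots> \<le> psum s (f x) (g y)"
      using \<open>0 < s\<close> ab m by (intro psum_mono) auto
    finally have "ennreal (m * M) \<le> ennreal (psum s (f x) (g y))"
      by (rule ennreal_leI)
    also have "\<dots> \<le> h (x + y)"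
      using that ab by (intro h) (auto simp: zero_less_divide_iff)
    finally have "ennreal (1 / M) * ennreal (m * M) \<le> ennreal (1 / M) * h (x + y)"
      by (rule mult_left_mono) simp
    then show ?thesis
      using M m(1) by (simp add: m_def flip: ennreal_mult)
  qed
  have near: "\<exists>x. u < f x / a" "\<exists>x. u < g x / b" if "u < 1" for u
  proof -
    have "u * a < a" "u * b < b"
      using that ab by auto
    then show "\<exists>x. u < f x / a" "\<exists>x. u < g x / b"
      using less_cSUP_iff[OF _ bdd(1), of "u * a"] less_cSUP_iff[OF _ bdd(2), of "u * b"] ab
      by (auto simp: a_def[symmetric] b_def[symmetric] pos_less_divide_eq)
  qed
  have scaled: "(\<integral>\<^sup>+x. ennreal (k x / c) \<partial>lborel) = ennreal (C / c)"
    if "k \<in> borel_measurable borel" "\<And>x. 0 \<le> k x" "0 < c" "0 \<le> C"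
      "(\<integral>\<^sup>+x. ennreal (k x) \<partial>lborel) = ennreal C" for k :: "real \<Rightarrow> real" and c C
  proof -
    have "(\<integral>\<^sup>+x. ennreal (k x / c) \<partial>lborel) = (\<integral>\<^sup>+x. ennreal (1 / c) * ennreal (k x) \<partial>lborel)"
      using that by (simp flip: ennreal_mult)
    also have "\<dots> = ennreal (1 / c) * ennreal C"
      using that by (subst nn_integral_cmult) auto
    finally show ?thesis
      using that by (simp flip: ennreal_mult)
  qed
  have "ennreal (A / a + B / b)
      = (\<integral>\<^sup>+x. ennreal (f x / a) \<partial>lborel) + (\<integral>\<^sup>+x. ennreal (g x / b) \<partial>lborel)"
    using scaled[of f a A] scaled[of g b B] nonneg ab AB int by (simp add: ennreal_plus)
  also have "\<dots> \<le> (\<integral>\<^sup>+x. ennreal (1 / M) * h x \<partial>lborel)"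
    using le ab near normalised by (intro nn_integral_sum_le_of_min) (auto simp: divide_le_eq)
  also have "\<dots> = ennreal (1 / M) * (\<integral>\<^sup>+x. h x \<partial>lborel)"
    by (rule nn_integral_cmult) simp
  finally have "ennreal M * ennreal (A / a + B / b)
      \<le> ennreal M * (ennreal (1 / M) * (\<integral>\<^sup>+x. h x \<partial>lborel))"
    by (rule mult_left_mono) simp
  moreover have "ennreal M * (ennreal (1 / M) * z) = z" for z
    using M by (simp add: mult.assoc[symmetric] flip: ennreal_mult)
  ultimately have "ennreal (M * (A / a + B / b)) \<le> (\<integral>\<^sup>+x. h x \<partial>lborel)"
    using M ab AB by (simp add: ennreal_mult)
  moreover have "psum (1 + s) A B \<le> M * (A / a + B / b)"
    unfolding M_def using \<open>0 < s\<close> ab AB by (rule psum_le_weighted)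
  ultimately show ?thesis
    by (meson ennreal_leI order_trans)
qed

text \<open>
  Truncating \<open>f\<close> and \<open>g\<close> at height \<open>k\<close> only weakens the hypothesis on \<open>h\<close>, and the truncated integrals
  converge to \<open>A\<close> and \<open>B\<close>.
\<close>

lemma borell_brascamp_lieb_real:
  fixes f g :: "real \<Rightarrow> real" and h :: "real \<Rightarrow> ennreal"
  assumes "0 < s"
    and [measurable]: "f \<in> borel_measurable borel" "g \<in> borel_measurable borel"
      "h \<in> borel_measurable borel"
    and nonneg: "\<And>x. 0 \<le> f x" "\<And>x. 0 \<le> g x"
    and pos: "\<exists>x. 0 < f x" "\<exists>x. 0 < g x"
    and int: "(\<integral>\<^sup>+x. ennreal (f x) \<partial>lborel) = ennreal A" "(\<integral>\<^sup>+x. ennreal (g x) \<partial>lborel) = ennreal B"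
    and AB: "0 \<le> A" "0 \<le> B"
    and h: "\<And>x y. 0 < f x \<Longrightarrow> 0 < g y \<Longrightarrow> ennreal (psum s (f x) (g y)) \<le> h (x + y)"
  shows "ennreal (psum (1 + s) A B) \<le> (\<integral>\<^sup>+x. h x \<partial>lborel)"
proof -
  define I where "I = (\<lambda>(f :: real \<Rightarrow> real) k. enn2real (\<integral>\<^sup>+x. ennreal (min (f x) (real k)) \<partial>lborel))"
  have fin: "(\<integral>\<^sup>+x. ennreal (min (f x) (real k)) \<partial>lborel) = ennreal (I f k)"
    if "(\<integral>\<^sup>+x. ennreal (f x) \<partial>lborel) = ennreal C" for f C k
  proof -
    have "(\<integral>\<^sup>+x. ennreal (min (f x) (real k)) \<partial>lborel) \<le> (\<integral>\<^sup>+x. ennreal (f x) \<partial>lborel)"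
      by (intro nn_integral_mono ennreal_leI) auto
    also have "\<dots> < top"
      using that by simp
    finally show ?thesis
      by (simp add: I_def)
  qed
  have lim: "I f \<longlonglongrightarrow> C"
    if [measurable]: "f \<in> borel_measurable borel" and "0 \<le> C"
      "(\<integral>\<^sup>+x. ennreal (f x) \<partial>lborel) = ennreal C" for f C
  proof -
    have "(\<lambda>k. \<integral>\<^sup>+x. ennreal (min (f x) (real k)) \<partial>lborel) \<longlonglongrightarrow> (\<integral>\<^sup>+x. ennreal (f x) \<partial>lborel)"
    proof (rule nn_integral_LIMSEQ)
      show "incseq (\<lambda>k x. ennreal (min (f x) (real k)))"
        by (auto simp: incseq_def le_fun_def intro!: ennreal_leI)
      show "(\<lambda>k. ennreal (min (f x) (real k))) \<longlonglongrightarrow> ennreal (f x)" for x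
      proof (rule tendsto_eventually)
        show "\<forall>\<^sub>F k in sequentially. ennreal (min (f x) (real k)) = ennreal (f x)"
          using eventually_ge_at_top[of "nat \<lceil>f x\<rceil>"]
          by eventually_elim (simp add: min_absorb1 nat_le_iff ceiling_le_iff)
      qed
    qed simp
    then show ?thesis
      using that by (simp add: fin[OF that(3)]) (simp add: I_def)
  qed
  have "(\<lambda>k. psum (1 + s) (I f k) (I g k)) \<longlonglongrightarrow> psum (1 + s) A B"
    using \<open>0 < s\<close> AB int by (intro tendsto_psum lim) (auto simp: I_def)
  then have "(\<lambda>k. ennreal (psum (1 + s) (I f k) (I g k))) \<longlonglongrightarrow> ennreal (psum (1 + s) A B)"
    by (intro tendsto_ennrealI)
  moreover have "ennreal (psum (1 + s) (I f k) (I g k)) \<le> (\<integral>\<^sup>+x. h x \<partial>lborel)" if "1 \<le> k" for k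
  proof (rule borell_brascamp_lieb_real_bounded)
    show "ennreal (psum s (min (f x) (real k)) (min (g y) (real k))) \<le> h (x + y)"
      if xy: "0 < min (f x) (real k)" "0 < min (g y) (real k)" for x y
    proof -
      have "psum s (min (f x) (real k)) (min (g y) (real k)) \<le> psum s (f x) (g y)"
        using xy \<open>0 < s\<close> by (intro psum_mono) auto
      moreover have "ennreal (psum s (f x) (g y)) \<le> h (x + y)"
        using xy by (intro h) auto
      ultimately show ?thesis
        by (meson ennreal_leI order_trans)
    qed
    show "bdd_above (range (\<lambda>x. min (f x) (real k)))" "bdd_above (range (\<lambda>x. min (g x) (real k)))"
      by (auto intro!: bdd_aboveI[where M="real k"])
  qed (use \<open>0 < s\<close> nonneg pos that fin int in \<open>auto simp: I_def\<close>)
  ultimately show ?thesis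
    by (intro LIMSEQ_le_const2) auto
qed

text \<open>
  The induction on the dimension integrates out all coordinates but one. For fixed values \<open>a\<close> and \<open>b\<close> of
  the last coordinate of \<open>x\<close> and \<open>y\<close>, the induction hypothesis applies to the sections and yields the
  one-dimensional hypothesis for the functions that integrate the sections, with \<open>s\<close> raised
  by the number of coordinates that were integrated out. The inequality on the line raises it once more.
  The integrals of \<open>f\<close> and \<open>g\<close> have to be positive: if \<open>f\<close> vanishes then nothing is known about \<open>h\<close>.

  Working over a finite index set rather than over a type of fixed dimension is what makes the
  induction possible. In dimension zero the claim is the pointwise hypothesis.
\<close>

lemma borell_brascamp_lieb_PiM:
  fixes f g :: "('i \<Rightarrow> real) \<Rightarrow> real" and h :: "('i \<Rightarrow> real) \<Rightarrow> ennreal"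
  assumes "finite I" "0 < s"
    and "f \<in> borel_measurable (\<Pi>\<^sub>M i\<in>I. lborel)" "g \<in> borel_measurable (\<Pi>\<^sub>M i\<in>I. lborel)"
      "h \<in> borel_measurable (\<Pi>\<^sub>M i\<in>I. lborel)"
    and "\<And>x. 0 \<le> f x" "\<And>x. 0 \<le> g x"
    and "(\<integral>\<^sup>+x. ennreal (f x) \<partial>(\<Pi>\<^sub>M i\<in>I. lborel)) = ennreal A"
      "(\<integral>\<^sup>+x. ennreal (g x) \<partial>(\<Pi>\<^sub>M i\<in>I. lborel)) = ennreal B"
    and "0 < A" "0 < B"
    and "\<And>x y. x \<in> extensional I \<Longrightarrow> y \<in> extensional I \<Longrightarrow> 0 < f x \<Longrightarrow> 0 < g y
      \<Longrightarrow> ennreal (psum s (f x) (g y)) \<le> h (\<lambda>i\<in>I. x i + y i)"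
  shows "ennreal (psum (real (card I) + s) A B) \<le> (\<integral>\<^sup>+x. h x \<partial>(\<Pi>\<^sub>M i\<in>I. lborel))"
  using assms
proof (induction I arbitrary: f g h A B rule: finite_induct)
  case empty
  interpret product_sigma_finite "\<lambda>_::'i. lborel :: real measure"
    by standard
  have *: "(\<integral>\<^sup>+x. k x \<partial>(\<Pi>\<^sub>M i\<in>{}. lborel)) = k (\<lambda>_. undefined)" for k :: "('i \<Rightarrow> real) \<Rightarrow> ennreal"
    by (simp add: PiM_empty nn_integral_count_space_finite)
  have "f (\<lambda>_. undefined) = A" "g (\<lambda>_. undefined) = B"
    using empty by (auto simp: *)
  then show ?case
    using empty.prems(11)[of "\<lambda>_. undefined" "\<lambda>_. undefined"] empty.prems(9,10)
    by (auto simp: * restrict_def)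
next
  case (insert i I)
  interpret product_sigma_finite "\<lambda>_::'i. lborel :: real measure"
    by standard
  let ?N = "\<Pi>\<^sub>M i\<in>I. (lborel :: real measure)"
  interpret N: sigma_finite_measure ?N
    using insert by (intro sigma_finite) auto
  note [measurable] = insert.prems(2-4)
  have upd [measurable]: "(\<lambda>(y, x). x(i := y)) \<in> borel \<Otimes>\<^sub>M ?N \<rightarrow>\<^sub>M (\<Pi>\<^sub>M i\<in>insert i I. lborel)"
    using measurable_compose[OF measurable_pair_swap' measurable_add_dim[of i I "\<lambda>_. lborel"]]
    by (simp add: case_prod_beta' cong: measurable_cong_sets sets_pair_measure_cong)
  have upd1 [measurable]: "(\<lambda>x. x(i := y)) \<in> ?N \<rightarrow>\<^sub>M (\<Pi>\<^sub>M i\<in>insert i I. lborel)" for y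
    using measurable_compose[OF measurable_Pair1'[of y borel ?N] upd] by simp
  define S where "S = (\<lambda>(k :: ('i \<Rightarrow> real) \<Rightarrow> real) a. \<integral>\<^sup>+x. ennreal (k (x(i := a))) \<partial>?N)"
  \<comment> \<open>The integral of a section may be infinite, but only on a null set. There \<open>enn2real\<close> makes \<open>F\<close> vanish,
    so that sections with \<open>0 < F k a\<close> are integrable.\<close>
  define F where "F = (\<lambda>k a. enn2real (S k a))"
  have S_meas [measurable]: "S k \<in> borel_measurable borel"
    if [measurable]: "k \<in> borel_measurable (\<Pi>\<^sub>M i\<in>insert i I. lborel)" for k
    unfolding S_def by measurable
  have F_int: "(\<integral>\<^sup>+a. ennreal (F k a) \<partial>lborel) = ennreal C"
    if [measurable]: "k \<in> borel_measurable (\<Pi>\<^sub>M i\<in>insert i I. lborel)"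
      and C: "(\<integral>\<^sup>+x. ennreal (k x) \<partial>(\<Pi>\<^sub>M i\<in>insert i I. lborel)) = ennreal C" for k C
  proof -
    have S: "(\<integral>\<^sup>+a. S k a \<partial>lborel) = ennreal C"
      unfolding C[symmetric] S_def using insert by (subst product_nn_integral_insert_rev) auto
    then have "AE a in lborel. S k a \<noteq> \<infinity>"
      by (intro nn_integral_noteq_infinite) auto
    then have "AE a in lborel. ennreal (F k a) = S k a"
      by eventually_elim (simp add: F_def less_top)
    then show ?thesis
      using S by (simp cong: nn_integral_cong_AE)
  qed
  have F_pos: "\<exists>a. 0 < F k a"
    if "0 < C" "(\<integral>\<^sup>+a. ennreal (F k a) \<partial>lborel) = ennreal C" for k C
  proof (rule ccontr)
    assume "\<nexists>a. 0 < F k a"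
    then have "F k a = 0" for a
      by (metis F_def enn2real_nonneg antisym_conv2)
    with that show False by simp
  qed
  have "ennreal (psum (1 + (real (card I) + s)) A B)
      \<le> (\<integral>\<^sup>+a. (\<integral>\<^sup>+x. h (x(i := a)) \<partial>?N) \<partial>lborel)"
  proof (rule borell_brascamp_lieb_real)
    show "F f \<in> borel_measurable borel" "F g \<in> borel_measurable borel"
      unfolding F_def by measurable
    show "(\<lambda>a. \<integral>\<^sup>+x. h (x(i := a)) \<partial>?N) \<in> borel_measurable borel"
      by measurable
    show "(\<integral>\<^sup>+a. ennreal (F f a) \<partial>lborel) = ennreal A" "(\<integral>\<^sup>+a. ennreal (F g a) \<partial>lborel) = ennreal B"
      using insert.prems by (auto intro: F_int)
    then show "\<exists>a. 0 < F f a" "\<exists>a. 0 < F g a"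
      using insert.prems(9,10) by (auto intro: F_pos)
    fix a b
    assume ab: "0 < F f a" "0 < F g b"
    show "ennreal (psum (real (card I) + s) (F f a) (F g b)) \<le> (\<integral>\<^sup>+x. h (x(i := a + b)) \<partial>?N)"
    proof (rule insert.IH)
      show "(\<lambda>x. f (x(i := a))) \<in> borel_measurable ?N" "(\<lambda>x. g (x(i := b))) \<in> borel_measurable ?N"
        "(\<lambda>x. h (x(i := a + b))) \<in> borel_measurable ?N"
        by measurable
      show "(\<integral>\<^sup>+x. ennreal (f (x(i := a))) \<partial>?N) = ennreal (F f a)"
        "(\<integral>\<^sup>+x. ennreal (g (x(i := b))) \<partial>?N) = ennreal (F g b)"
        using ab by (auto simp: F_def S_def enn2real_positive_iff)
      fix x y
      assume xy: "x \<in> extensional I" "y \<in> extensional I" "0 < f (x(i := a))" "0 < g (y(i := b))"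
      then have ext: "x(i := a) \<in> extensional (insert i I)" "y(i := b) \<in> extensional (insert i I)"
        by (auto simp: extensional_def)
      have "ennreal (psum s (f (x(i := a))) (g (y(i := b))))
          \<le> h (\<lambda>j\<in>insert i I. (x(i := a)) j + (y(i := b)) j)"
        using ext xy by (intro insert.prems(11))
      also have "(\<lambda>j\<in>insert i I. (x(i := a)) j + (y(i := b)) j) = (\<lambda>j\<in>I. x j + y j)(i := a + b)"
        using insert.hyps by (auto simp: restrict_def)
      finally show "ennreal (psum s (f (x(i := a))) (g (y(i := b))))
          \<le> h ((\<lambda>j\<in>I. x j + y j)(i := a + b))" .
    qed (use ab insert.prems in auto)
  qed (use insert.prems in \<open>auto simp: F_def\<close>)
  also have "\<dots> = (\<integral>\<^sup>+x. h x \<partial>(\<Pi>\<^sub>M i\<in>insert i I. lborel))"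
    using insert by (subst product_nn_integral_insert_rev) auto
  finally show ?case
    using insert.hyps by (simp add: add.commute add.left_commute)
qed

lemma nn_integral_lborel_PiM:
  fixes k :: "'a::euclidean_space \<Rightarrow> ennreal"
  assumes [measurable]: "k \<in> borel_measurable borel"
  shows "(\<integral>\<^sup>+x. k x \<partial>lborel)
    = (\<integral>\<^sup>+v. k (\<Sum>b\<in>Basis. v b *\<^sub>R b) \<partial>(\<Pi>\<^sub>M b\<in>Basis. lborel))"
  by (subst lborel_eq) (subst nn_integral_distr, auto)

theorem borell_brascamp_lieb:
  fixes f g :: "'a::euclidean_space \<Rightarrow> real" and h :: "'a \<Rightarrow> ennreal"
  assumes "0 < s"
    and [measurable]: "f \<in> borel_measurable borel" "g \<in> borel_measurable borel"
      "h \<in> borel_measurable borel"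
    and nonneg: "\<And>x. 0 \<le> f x" "\<And>x. 0 \<le> g x"
    and int: "(\<integral>\<^sup>+x. ennreal (f x) \<partial>lborel) = ennreal A" "(\<integral>\<^sup>+x. ennreal (g x) \<partial>lborel) = ennreal B"
    and AB: "0 < A" "0 < B"
    and h: "\<And>x y. 0 < f x \<Longrightarrow> 0 < g y \<Longrightarrow> ennreal (psum s (f x) (g y)) \<le> h (x + y)"
  shows "ennreal (psum (real DIM('a) + s) A B) \<le> (\<integral>\<^sup>+x. h x \<partial>lborel)"
proof -
  let ?T = "\<lambda>v. \<Sum>b\<in>(Basis :: 'a set). v b *\<^sub>R b"
  have "ennreal (psum (real (card (Basis :: 'a set)) + s) A B)
      \<le> (\<integral>\<^sup>+v. h (?T v) \<partial>(\<Pi>\<^sub>M b\<in>Basis. lborel))"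
  proof (rule borell_brascamp_lieb_PiM)
    show "(\<integral>\<^sup>+v. ennreal (f (?T v)) \<partial>(\<Pi>\<^sub>M b\<in>Basis. lborel)) = ennreal A"
      "(\<integral>\<^sup>+v. ennreal (g (?T v)) \<partial>(\<Pi>\<^sub>M b\<in>Basis. lborel)) = ennreal B"
      by (simp_all flip: int add: nn_integral_lborel_PiM)
    fix v w
    assume "0 < f (?T v)" "0 < g (?T w)"
    then have "ennreal (psum s (f (?T v)) (g (?T w))) \<le> h (?T v + ?T w)"
      by (rule h)
    also have "?T v + ?T w = ?T (\<lambda>b\<in>Basis. v b + w b)"
      by (simp add: scaleR_add_left sum.distrib)
    finally show "ennreal (psum s (f (?T v)) (g (?T w))) \<le> h (?T (\<lambda>b\<in>Basis. v b + w b))" .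
  qed (use \<open>0 < s\<close> nonneg AB in \<open>auto\<close>)
  then show ?thesis
    by (simp add: nn_integral_lborel_PiM)
qed

lemma nn_integral_lebesgue_scale:
  fixes f :: "'a::euclidean_space \<Rightarrow> ennreal"
  assumes [measurable]: "f \<in> borel_measurable lebesgue" and "0 < c"
  shows "(\<integral>\<^sup>+x. f (c *\<^sub>R x) \<partial>lebesgue) = ennreal (1 / c ^ DIM('a)) * (\<integral>\<^sup>+x. f x \<partial>lebesgue)"
proof -
  have T: "(\<lambda>x. 0 + (\<Sum>j\<in>Basis. (c * (x \<bullet> j)) *\<^sub>R j)) = (*\<^sub>R) c" for c :: real
    unfolding scaleR_scaleR[symmetric] scaleR_sum_right[symmetric] euclidean_representation by simp
  have "(lebesgue :: 'a measure) = density (distr lebesgue lebesgue ((*\<^sub>R) c)) (\<lambda>_. \<Prod>j\<in>(Basis :: 'a set). \<bar>c\<bar>)"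
    using lebesgue_affine_euclidean[of "\<lambda>_::'a. c" 0] \<open>0 < c\<close> unfolding T by simp
  then have "(\<integral>\<^sup>+x. f x \<partial>lebesgue)
      = (\<integral>\<^sup>+x. f x \<partial>density (distr lebesgue lebesgue ((*\<^sub>R) c)) (\<lambda>_. ennreal (c ^ DIM('a))))"
    using \<open>0 < c\<close> by simp
  also have "\<dots> = (\<integral>\<^sup>+x. ennreal (c ^ DIM('a)) * f x \<partial>distr lebesgue lebesgue ((*\<^sub>R) c))"
    by (subst nn_integral_density) auto
  also have "\<dots> = (\<integral>\<^sup>+x. ennreal (c ^ DIM('a)) * f (c *\<^sub>R x) \<partial>lebesgue)"
    by (subst nn_integral_distr) auto
  also have "\<dots> = ennreal (c ^ DIM('a)) * (\<integral>\<^sup>+x. f (c *\<^sub>R x) \<partial>lebesgue)"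
    by (rule nn_integral_cmult) (rule measurable_compose[OF lebesgue_measurable_scaling assms(1)])
  finally show ?thesis
    using \<open>0 < c\<close> by (simp add: mult.assoc[symmetric] flip: ennreal_mult)
qed

lemma nn_integral_lborel_shift:
  fixes f :: "'a::euclidean_space \<Rightarrow> ennreal"
  assumes [measurable]: "f \<in> borel_measurable borel"
  shows "(\<integral>\<^sup>+x. f (v + x) \<partial>lborel) = (\<integral>\<^sup>+x. f x \<partial>lborel)"
proof -
  have "(\<integral>\<^sup>+x. f x \<partial>lborel) = (\<integral>\<^sup>+x. f x \<partial>distr lborel borel (\<lambda>x. v + x))"
    by (simp only: lborel_distr_plus)
  also have "\<dots> = (\<integral>\<^sup>+x. f (v + x) \<partial>lborel)"
    by (rule nn_integral_distr) auto
  finally show ?thesis ..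
qed

section \<open>Lebesgue measurable functions\<close>

text \<open>
  The pointwise hypothesis of the Borell--Brascamp--Lieb inequality survives when \<open>f\<close> and \<open>g\<close> decrease
  and \<open>h\<close> increases. Lebesgue measurable functions can therefore be replaced by Borel functions with
  the same integrals, changing them only on null sets and only in the favourable direction.
\<close>

lemma lebesgue_borel_minorant:
  fixes f :: "'a::euclidean_space \<Rightarrow> real"
  assumes "f \<in> borel_measurable lebesgue" and nonneg: "\<And>x. 0 \<le> f x"
  obtains f' where "f' \<in> borel_measurable borel" "\<And>x. 0 \<le> f' x" "\<And>x. f' x \<le> f x"
    "AE x in lborel. f' x = f x"
proof -
  obtain f0 where [measurable]: "f0 \<in> borel_measurable lborel" and ae: "AE x in lborel. f x = f0 x"
    using completion_ex_borel_measurable_real[OF assms(1)] by auto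
  from ae obtain N where "\<And>x. x \<in> space lborel - N \<Longrightarrow> f x = f0 x" and "N \<in> null_sets lborel"
    by (rule AE_E3) blast
  then have N: "\<And>x. x \<notin> N \<Longrightarrow> f x = f0 x" "N \<in> null_sets lborel"
    by auto
  then have [measurable]: "N \<in> sets borel"
    by (auto simp: null_sets_def)
  show thesis
  proof (rule that)
    show "(\<lambda>x. if x \<in> N then 0 else f0 x) \<in> borel_measurable borel"
      by measurable
    show "AE x in lborel. (if x \<in> N then 0 else f0 x) = f x"
      using AE_not_in[OF N(2)] by eventually_elim (simp add: N)
  qed (use N nonneg in \<open>auto simp flip: N(1)\<close>)
qed

lemma lebesgue_borel_majorant:
  fixes h :: "'a::euclidean_space \<Rightarrow> ennreal"
  assumes "h \<in> borel_measurable lebesgue"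
  obtains h' where "h' \<in> borel_measurable borel" "\<And>x. h x \<le> h' x" "AE x in lborel. h' x = h x"
proof -
  obtain h0 where [measurable]: "h0 \<in> borel_measurable lborel" and ae: "AE x in lborel. h x = h0 x"
    using completion_ex_borel_measurable[OF assms(1)] by auto
  from ae obtain N where "\<And>x. x \<in> space lborel - N \<Longrightarrow> h x = h0 x" and "N \<in> null_sets lborel"
    by (rule AE_E3) blast
  then have N: "\<And>x. x \<notin> N \<Longrightarrow> h x = h0 x" "N \<in> null_sets lborel"
    by auto
  then have [measurable]: "N \<in> sets borel"
    by (auto simp: null_sets_def)
  show thesis
  proof (rule that)
    show "(\<lambda>x. if x \<in> N then top else h0 x) \<in> borel_measurable borel"
      by measurable
    show "AE x in lborel. (if x \<in> N then top else h0 x) = h x"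
      using AE_not_in[OF N(2)] by eventually_elim (simp add: N)
  qed (use N in auto)
qed

section \<open>The integral of the L_p supremal convolution\<close>

lemma lp_coeff_nonneg: "0 \<le> lp_coeff p t"
  by (simp add: lp_coeff_def pow0_def)

lemma lp_coeff_one [simp]: "lp_coeff p 1 = 1"
  by (simp add: lp_coeff_def pow0_def)

lemma lp_coeff_pos: "0 < t \<Longrightarrow> 0 < lp_coeff p t"
  by (simp add: lp_coeff_def pow0_def)

lemma lp_coeff_eq_powr: "0 < t \<Longrightarrow> lp_coeff p t = t powr (1 - 1 / p)"
  by (simp add: lp_coeff_def pow0_def)

lemma lps_sup_conv_ge:
  assumes "0 < f x" "0 < g y" "0 \<le> t" "t \<le> 1"
  shows "ennreal ((lp_coeff p (1 - t) * f x powr (1 / s) + lp_coeff p t * g y powr (1 / s)) powr s)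
    \<le> lps_sup_conv p s f g (lp_coeff p (1 - t) *\<^sub>R x + lp_coeff p t *\<^sub>R y)"
proof -
  have "x \<in> fsupp f" "y \<in> fsupp g"
    using assms closure_subset[of "{x. 0 < f x}"] closure_subset[of "{x. 0 < g x}"]
    by (auto simp: fsupp_def)
  then show ?thesis
    unfolding lps_sup_conv_def lp_sum_def using assms
    by (auto intro!: Sup_upper)
qed

lemma fsupp_nonempty_iff: "fsupp f \<noteq> {} \<longleftrightarrow> (\<exists>x. 0 < f x)"
  by (auto simp: fsupp_def)

text \<open>
  As a function of \<open>t\<close>, the left-hand side of the last equation is at most the right-hand side, by
  Hoelder's inequality. The parameter chosen here is the case of equality, and turns the linear sums of
  the case \<open>p = 1\<close> into \<open>l\<^sub>p\<close> sums.
\<close>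

lemma lp_optimal_parameter:
  fixes a b :: real
  assumes "1 \<le> p" "0 < a" "0 < b"
  defines "t \<equiv> b powr p / (a powr p + b powr p)"
  shows "0 < t" "t < 1"
    and "lp_coeff p (1 - t) * a + lp_coeff p t * b = (a powr p + b powr p) powr (1 / p)"
proof -
  let ?S = "a powr p + b powr p"
  have S: "0 < ?S"
    using assms by (simp add: add_pos_pos)
  show t: "0 < t" "t < 1"
    using assms S by (auto simp: t_def)
  have t': "1 - t = a powr p / ?S"
    using S by (simp add: t_def field_simps)
  have summand: "(c powr p / ?S) powr (1 - 1 / p) * c = c powr p / ?S powr (1 - 1 / p)" if "0 < c" for c
  proof -
    have "(c powr p) powr (1 - 1 / p) * c powr 1 = c powr (p * (1 - 1 / p) + 1)"
      by (simp only: powr_powr powr_add)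
    also have "p * (1 - 1 / p) + 1 = p"
      using assms(1) by (simp add: right_diff_distrib)
    finally have "(c powr p) powr (1 - 1 / p) * c powr 1 = c powr p" .
    then show ?thesis
      using that S by (simp add: powr_divide)
  qed
  have "lp_coeff p (1 - t) * a + lp_coeff p t * b
      = a powr p / ?S powr (1 - 1 / p) + b powr p / ?S powr (1 - 1 / p)"
    using t by (simp add: lp_coeff_eq_powr summand[OF assms(2), folded t'] summand[OF assms(3), folded t_def])
  also have "\<dots> = ?S powr 1 / ?S powr (1 - 1 / p)"
    using S by (simp flip: add_divide_distrib)
  also have "\<dots> = ?S powr (1 / p)"
    by (simp only: powr_diff[symmetric] diff_diff_eq2) simp
  finally show "lp_coeff p (1 - t) * a + lp_coeff p t * b = ?S powr (1 / p)" .
qed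

text \<open>
  For one fixed \<open>t\<close>, the coefficients can be absorbed into \<open>f\<close> and \<open>g\<close>: the dilated functions
  \<open>c\<^sup>s f(x / c)\<close> and \<open>d\<^sup>s g(y / d)\<close> satisfy the hypothesis of the additive inequality, and dilating
  multiplies the \<open>(n + s)\<close>-th root of the integral by \<open>c\<close> and \<open>d\<close> respectively. The optimal \<open>t\<close> then gives
  the claim.
\<close>

lemma lp_borell_brascamp_lieb_borel:
  fixes f g :: "'a::euclidean_space \<Rightarrow> real" and h :: "'a \<Rightarrow> ennreal"
  assumes "1 \<le> p" "0 < s"
    and [measurable]: "f \<in> borel_measurable borel" "g \<in> borel_measurable borel"
      "h \<in> borel_measurable borel"
    and nonneg: "\<And>x. 0 \<le> f x" "\<And>x. 0 \<le> g x"
    and int: "(\<integral>\<^sup>+x. ennreal (f x) \<partial>lborel) = ennreal A" "(\<integral>\<^sup>+x. ennreal (g x) \<partial>lborel) = ennreal B"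
    and AB: "0 < A" "0 < B"
    and h: "\<And>x y t. 0 < f x \<Longrightarrow> 0 < g y \<Longrightarrow> 0 < t \<Longrightarrow> t < 1 \<Longrightarrow>
      ennreal ((lp_coeff p (1 - t) * f x powr (1 / s) + lp_coeff p t * g y powr (1 / s)) powr s)
        \<le> h (lp_coeff p (1 - t) *\<^sub>R x + lp_coeff p t *\<^sub>R y)"
  shows "ennreal (psum ((real DIM('a) + s) / p) A B) \<le> (\<integral>\<^sup>+x. h x \<partial>lborel)"
proof -
  define m where "m = real DIM('a) + s"
  have m: "0 < m"
    using \<open>0 < s\<close> by (simp add: m_def add_nonneg_pos)
  let ?a = "A powr (1 / m)" and ?b = "B powr (1 / m)"
  \<comment> \<open>The integrals enter through their \<open>(n + s)\<close>-th roots, because these are the quantities that the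
    dilation by \<open>c\<close> or \<open>d\<close> multiplies by \<open>c\<close> or \<open>d\<close>.\<close>
  define t where "t = ?b powr p / (?a powr p + ?b powr p)"
  define c d where "c = lp_coeff p (1 - t)" and "d = lp_coeff p t"
  have t: "0 < t" "t < 1" and opt: "c * ?a + d * ?b = (?a powr p + ?b powr p) powr (1 / p)"
    using lp_optimal_parameter[OF \<open>1 \<le> p\<close>, of ?a ?b] AB by (auto simp: t_def c_def d_def)
  have cd: "0 < c" "0 < d"
    using t by (auto simp: c_def d_def intro: lp_coeff_pos)
  define F where "F = (\<lambda>(f :: 'a \<Rightarrow> real) c x. c powr s * f ((1 / c) *\<^sub>R x))"
  have F_int: "(\<integral>\<^sup>+x. ennreal (F f c x) \<partial>lborel) = ennreal (c powr m * C)"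
    if [measurable]: "f \<in> borel_measurable borel" and "\<And>x. 0 \<le> f x" "0 < c" "0 \<le> C"
      "(\<integral>\<^sup>+x. ennreal (f x) \<partial>lborel) = ennreal C" for f c C
  proof -
    have "(\<integral>\<^sup>+x. ennreal (F f c x) \<partial>lborel)
        = ennreal (c powr s) * (\<integral>\<^sup>+x. ennreal (f ((1 / c) *\<^sub>R x)) \<partial>lborel)"
      using that by (simp add: F_def ennreal_mult nn_integral_cmult)
    also have "\<dots> = ennreal (c powr s) * (ennreal (1 / (1 / c) ^ DIM('a)) * ennreal C)"
      using that nn_integral_lebesgue_scale[of "\<lambda>x. ennreal (f x)" "1 / c"]
      by (simp add: nn_integral_completion measurable_completion)
    also have "\<dots> = ennreal (c powr m * C)"
      using that by (simp add: m_def powr_add powr_realpow power_divide mult_ac flip: ennreal_mult)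
    finally show ?thesis .
  qed
  have "ennreal (psum (real DIM('a) + s) (c powr m * A) (d powr m * B)) \<le> (\<integral>\<^sup>+x. h x \<partial>lborel)"
  proof (rule borell_brascamp_lieb)
    fix x y
    assume xy: "0 < F f c x" "0 < F g d y"
    then have pos: "0 < f ((1 / c) *\<^sub>R x)" "0 < g ((1 / d) *\<^sub>R y)"
      using cd by (auto simp: F_def zero_less_mult_iff)
    have "psum s (F f c x) (F g d y)
        = (c * f ((1 / c) *\<^sub>R x) powr (1 / s) + d * g ((1 / d) *\<^sub>R y) powr (1 / s)) powr s"
      using cd nonneg \<open>0 < s\<close> by (simp add: psum_def F_def powr_mult powr_powr)
    also have "ennreal \<dots> \<le> h (x + y)"
      using h[OF pos t] cd by (simp add: c_def d_def)
    finally show "ennreal (psum s (F f c x) (F g d y)) \<le> h (x + y)" .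
  qed (use assms cd F_int in \<open>auto simp: F_def\<close>)
  moreover have "psum (real DIM('a) + s) (c powr m * A) (d powr m * B) = psum (m / p) A B"
    using m cd AB opt \<open>1 \<le> p\<close>
    by (simp add: psum_def powr_mult powr_powr flip: m_def)
  ultimately show ?thesis
    by (simp add: m_def)
qed

text \<open>
  If one integral vanishes, \<open>psum\<close> returns the other integral. The convolution dominates a
  translate of \<open>f\<close> (take \<open>t = 0\<close> and a fixed point \<open>y\<close> with \<open>g y > 0\<close>) and, with \<open>t = 1\<close>, a translate of \<open>g\<close>.
  The translation is nontrivial only for \<open>p = 1\<close>, where the coefficient of the fixed point is one. The
  fixed point is chosen with the original function, as the Borel minorant may vanish identically.
\<close>

theorem nn_integral_lps_sup_conv_ge:
  fixes f g :: "'a::euclidean_space \<Rightarrow> real"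
  assumes "1 \<le> p" "0 < s"
    and nonneg: "\<And>x. 0 \<le> f x" "\<And>x. 0 \<le> g x"
    and int: "integrable lebesgue f" "integrable lebesgue g"
    and supp: "fsupp f \<noteq> {}" "fsupp g \<noteq> {}"
    and h: "lps_sup_conv p s f g \<in> borel_measurable lebesgue"
  shows "ennreal (psum ((real DIM('a) + s) / p) (integral\<^sup>L lebesgue f) (integral\<^sup>L lebesgue g))
    \<le> (\<integral>\<^sup>+z. lps_sup_conv p s f g z \<partial>lebesgue)"
proof -
  let ?h = "lps_sup_conv p s f g"
  define A B where "A = integral\<^sup>L lebesgue f" and "B = integral\<^sup>L lebesgue g"
  have AB: "0 \<le> A" "0 \<le> B"
    using nonneg by (auto simp: A_def B_def)
  obtain f' where f': "f' \<in> borel_measurable borel" "\<And>x. 0 \<le> f' x" "\<And>x. f' x \<le> f x"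
    "AE x in lborel. f' x = f x"
    using lebesgue_borel_minorant[OF borel_measurable_integrable[OF int(1)] nonneg(1)] by metis
  obtain g' where g': "g' \<in> borel_measurable borel" "\<And>x. 0 \<le> g' x" "\<And>x. g' x \<le> g x"
    "AE x in lborel. g' x = g x"
    using lebesgue_borel_minorant[OF borel_measurable_integrable[OF int(2)] nonneg(2)] by metis
  obtain h' where h': "h' \<in> borel_measurable borel" "\<And>x. ?h x \<le> h' x" "AE x in lborel. h' x = ?h x"
    using lebesgue_borel_majorant[OF h] by metis
  have int_h: "(\<integral>\<^sup>+z. ?h z \<partial>lebesgue) = (\<integral>\<^sup>+z. h' z \<partial>lborel)"
    unfolding nn_integral_completion using h'(3) by (intro nn_integral_cong_AE) auto
  have int_eq: "(\<integral>\<^sup>+x. ennreal (k' x) \<partial>lborel) = ennreal (integral\<^sup>L lebesgue k)"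
    if "AE x in lborel. k' x = k x" "integrable lebesgue k" "\<And>x. 0 \<le> k x" for k k' :: "'a \<Rightarrow> real"
  proof -
    have "(\<integral>\<^sup>+x. ennreal (k' x) \<partial>lborel) = (\<integral>\<^sup>+x. ennreal (k x) \<partial>lebesgue)"
      unfolding nn_integral_completion using that(1) by (intro nn_integral_cong_AE) auto
    also have "\<dots> = ennreal (integral\<^sup>L lebesgue k)"
      using that by (intro nn_integral_eq_integral) auto
    finally show ?thesis .
  qed
  have int': "(\<integral>\<^sup>+x. ennreal (f' x) \<partial>lborel) = ennreal A" "(\<integral>\<^sup>+x. ennreal (g' x) \<partial>lborel) = ennreal B"
    unfolding A_def B_def using f' g' int nonneg by (auto intro!: int_eq)
  have ge: "ennreal ((lp_coeff p (1 - t) * f' x powr (1 / s) + lp_coeff p t * g' y powr (1 / s)) powr s)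
      \<le> h' (lp_coeff p (1 - t) *\<^sub>R x + lp_coeff p t *\<^sub>R y)"
    if "0 < f x" "0 < g y" "0 \<le> t" "t \<le> 1" for x y t
  proof -
    have "ennreal ((lp_coeff p (1 - t) * f' x powr (1 / s) + lp_coeff p t * g' y powr (1 / s)) powr s)
      \<le> ennreal ((lp_coeff p (1 - t) * f x powr (1 / s) + lp_coeff p t * g y powr (1 / s)) powr s)"
      using f' g' \<open>0 < s\<close>
      by (intro ennreal_leI powr_mono2 add_mono mult_left_mono add_nonneg_nonneg mult_nonneg_nonneg)
        (auto simp: lp_coeff_nonneg)
    also have "\<dots> \<le> ?h (lp_coeff p (1 - t) *\<^sub>R x + lp_coeff p t *\<^sub>R y)"
      using that by (rule lps_sup_conv_ge)
    also have "\<dots> \<le> h' (lp_coeff p (1 - t) *\<^sub>R x + lp_coeff p t *\<^sub>R y)"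
      by (rule h')
    finally show ?thesis .
  qed
  have shifted: "(\<integral>\<^sup>+x. ennreal (k x) \<partial>lborel) \<le> (\<integral>\<^sup>+z. h' z \<partial>lborel)"
    if "\<And>x. 0 < k x \<Longrightarrow> ennreal (k x) \<le> h' (v + x)" for k :: "'a \<Rightarrow> real" and v
  proof -
    have "ennreal (k x) \<le> h' (v + x)" for x
      using that[of x] by (cases "0 < k x") (auto simp: ennreal_neg)
    then have "(\<integral>\<^sup>+x. ennreal (k x) \<partial>lborel) \<le> (\<integral>\<^sup>+x. h' (v + x) \<partial>lborel)"
      by (intro nn_integral_mono)
    then show ?thesis
      by (simp add: nn_integral_lborel_shift[OF h'(1)])
  qed
  have "ennreal A \<le> (\<integral>\<^sup>+z. h' z \<partial>lborel)"
  proof -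
    obtain y where y: "0 < g y"
      using supp by (auto simp: fsupp_nonempty_iff)
    show ?thesis
      unfolding int'(1)[symmetric]
    proof (rule shifted)
      fix x
      assume x: "0 < f' x"
      have "(f' x powr (1 / s)) powr s \<le> (f' x powr (1 / s) + lp_coeff p 0 * g' y powr (1 / s)) powr s"
        using \<open>0 < s\<close> by (intro powr_mono2) (auto simp: lp_coeff_nonneg)
      then have "ennreal (f' x) \<le> ennreal ((f' x powr (1 / s) + lp_coeff p 0 * g' y powr (1 / s)) powr s)"
        using x \<open>0 < s\<close> by (intro ennreal_leI) (simp add: powr_powr)
      also have "\<dots> \<le> h' (x + lp_coeff p 0 *\<^sub>R y)"
        using ge[of x y 0] x y less_le_trans[OF x f'(3)] by simp
      finally show "ennreal (f' x) \<le> h' (lp_coeff p 0 *\<^sub>R y + x)"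
        by (simp add: add.commute)
    qed
  qed
  moreover have "ennreal B \<le> (\<integral>\<^sup>+z. h' z \<partial>lborel)"
  proof -
    obtain x where x: "0 < f x"
      using supp by (auto simp: fsupp_nonempty_iff)
    show ?thesis
      unfolding int'(2)[symmetric]
    proof (rule shifted)
      fix y
      assume y: "0 < g' y"
      have "(g' y powr (1 / s)) powr s \<le> (lp_coeff p 0 * f' x powr (1 / s) + g' y powr (1 / s)) powr s"
        using \<open>0 < s\<close> by (intro powr_mono2) (auto simp: lp_coeff_nonneg)
      then have "ennreal (g' y) \<le> ennreal ((lp_coeff p 0 * f' x powr (1 / s) + g' y powr (1 / s)) powr s)"
        using y \<open>0 < s\<close> by (intro ennreal_leI) (simp add: powr_powr)
      also have "\<dots> \<le> h' (lp_coeff p 0 *\<^sub>R x + y)"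
        using ge[of x y 1] x y less_le_trans[OF y g'(3)] by simp
      finally show "ennreal (g' y) \<le> h' (lp_coeff p 0 *\<^sub>R x + y)" .
    qed
  qed
  moreover have "ennreal (psum ((real DIM('a) + s) / p) A B) \<le> (\<integral>\<^sup>+z. h' z \<partial>lborel)"
    if "0 < A" "0 < B"
    by (rule lp_borell_brascamp_lieb_borel[OF assms(1,2) f'(1) g'(1) h'(1) f'(2) g'(2) int' that])
      (auto intro!: ge intro: less_le_trans f'(3) g'(3))
  moreover have "0 < (real DIM('a) + s) / p"
    using assms(1,2) by (simp add: add_nonneg_pos)
  ultimately have "ennreal (psum ((real DIM('a) + s) / p) A B) \<le> (\<integral>\<^sup>+z. h' z \<partial>lborel)"
    using AB by (cases "A = 0"; cases "B = 0") auto
  then show ?thesis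
    by (simp add: A_def B_def int_h)
qed

lemma lps_scale_nonneg:
  assumes "\<And>x. 0 \<le> g x"
  shows "0 \<le> lps_scale p s l g x"
  by (simp add: lps_scale_def assms)

section \<open>Dilations\<close>

lemma has_bochner_integral_lps_scale:
  fixes g :: "'a::euclidean_space \<Rightarrow> real"
  assumes "0 < l" "integrable lebesgue g" and nonneg: "\<And>x. 0 \<le> g x"
  shows "has_bochner_integral lebesgue (lps_scale p s l g)
    (l powr ((real DIM('a) + s) / p) * integral\<^sup>L lebesgue g)"
proof (rule has_bochner_integral_nn_integral)
  have g [measurable]: "g \<in> borel_measurable lebesgue"
    using assms by auto
  have gc [measurable]: "(\<lambda>x. g (c *\<^sub>R x)) \<in> borel_measurable lebesgue" for c
    by (rule measurable_compose[OF lebesgue_measurable_scaling g])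
  show "lps_scale p s l g \<in> borel_measurable lebesgue"
    unfolding lps_scale_def by measurable
  define c where "c = l powr (- 1 / p)"
  have c: "0 < c"
    using \<open>0 < l\<close> by (simp add: c_def)
  have "(\<integral>\<^sup>+x. ennreal (lps_scale p s l g x) \<partial>lebesgue)
      = ennreal (l powr (s / p)) * (\<integral>\<^sup>+x. ennreal (g (c *\<^sub>R x)) \<partial>lebesgue)"
    using nonneg by (simp add: lps_scale_def c_def ennreal_mult nn_integral_cmult)
  also have "(\<integral>\<^sup>+x. ennreal (g (c *\<^sub>R x)) \<partial>lebesgue)
      = ennreal (1 / c ^ DIM('a)) * (\<integral>\<^sup>+x. ennreal (g x) \<partial>lebesgue)"
    using c by (intro nn_integral_lebesgue_scale) auto
  also have "(\<integral>\<^sup>+x. ennreal (g x) \<partial>lebesgue) = ennreal (integral\<^sup>L lebesgue g)"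
    using assms by (intro nn_integral_eq_integral) auto
  also have "1 / c ^ DIM('a) = l powr (real DIM('a) / p)"
  proof -
    have "c ^ DIM('a) = l powr (- 1 / p * real DIM('a))"
      using c by (simp only: c_def powr_powr flip: powr_realpow)
    also have "- 1 / p * real DIM('a) = - (real DIM('a) / p)"
      by simp
    finally show ?thesis
      by (simp add: powr_minus_divide)
  qed
  finally show "(\<integral>\<^sup>+x. ennreal (lps_scale p s l g x) \<partial>lebesgue)
      = ennreal (l powr ((real DIM('a) + s) / p) * integral\<^sup>L lebesgue g)"
    using nonneg by (simp add: add_divide_distrib powr_add mult_ac flip: ennreal_mult)
qed (use nonneg in \<open>auto simp: lps_scale_nonneg\<close>)

lemma fsupp_lps_scale:
  fixes g :: "'a::real_normed_vector \<Rightarrow> real"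
  assumes "0 < l"
  shows "fsupp (lps_scale p s l g) = (*\<^sub>R) (l powr (1 / p)) ` fsupp g"
proof -
  have inv: "l powr (- 1 / p) * l powr (1 / p) = 1" "l powr (1 / p) * l powr (- 1 / p) = 1"
    using assms by (simp_all flip: powr_add)
  have "{x. 0 < lps_scale p s l g x} = (*\<^sub>R) (l powr (1 / p)) ` {x. 0 < g x}"
  proof (intro set_eqI iffI)
    fix x
    assume "x \<in> {x. 0 < lps_scale p s l g x}"
    then have "0 < g (l powr (- 1 / p) *\<^sub>R x)"
      using assms by (simp add: lps_scale_def zero_less_mult_iff)
    then show "x \<in> (*\<^sub>R) (l powr (1 / p)) ` {x. 0 < g x}"
      using inv by (intro image_eqI[where x="l powr (- 1 / p) *\<^sub>R x"]) auto
  next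
    fix x
    assume "x \<in> (*\<^sub>R) (l powr (1 / p)) ` {x. 0 < g x}"
    then show "x \<in> {x. 0 < lps_scale p s l g x}"
      using assms inv by (auto simp: lps_scale_def)
  qed
  then show ?thesis
    by (simp add: fsupp_def closure_scaleR)
qed

section \<open>Passing to the limit\<close>

lemma tendsto_powr_quotient_at_0:
  fixes a b r :: real
  assumes "0 < a"
  shows "((\<lambda>e. ((a + e * b) powr r - a powr r) / e) \<longlongrightarrow> r * a powr (r - 1) * b) (at_right 0)"
proof -
  have "((\<lambda>e. (a + e * b) powr r) has_real_derivative r * a powr (r - 1) * b) (at 0 within {0<..})"
    using assms by (auto intro!: derivative_eq_intros simp: powr_diff)
  then show ?thesis
    by (simp add: has_field_derivative_iff)
qed

lemma lps_quotient_ge: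
  fixes f g :: "real^'n \<Rightarrow> real"
  assumes "1 \<le> p" "0 < s" "0 < e"
    and nonneg: "\<And>x. 0 \<le> f x" "\<And>x. 0 \<le> g x"
    and int: "integrable lebesgue f" "integrable lebesgue g"
    and supp: "fsupp f \<noteq> {}" "fsupp g \<noteq> {}"
    and h: "lps_sup_conv p s f (lps_scale p s e g) \<in> borel_measurable lebesgue"
  defines "r \<equiv> (real CARD('n) + s) / p"
  shows "ereal ((psum r (integral\<^sup>L lebesgue f) (e powr r * integral\<^sup>L lebesgue g)
      - integral\<^sup>L lebesgue f) / e) \<le> lps_quotient p s f g e"
proof -
  let ?P = "psum r (integral\<^sup>L lebesgue f) (e powr r * integral\<^sup>L lebesgue g)"
  note scaled = has_bochner_integral_lps_scale[OF \<open>0 < e\<close> int(2) nonneg(2), of p s]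
  then have scaled_int: "integrable lebesgue (lps_scale p s e g)"
    by (simp add: has_bochner_integral_iff)
  have "ennreal ?P \<le> (\<integral>\<^sup>+z. lps_sup_conv p s f (lps_scale p s e g) z \<partial>lebesgue)"
    using nn_integral_lps_sup_conv_ge[OF assms(1,2) nonneg(1) lps_scale_nonneg[OF nonneg(2)] int(1)
        scaled_int supp(1) _ h] supp(2) \<open>0 < e\<close>
    by (simp add: fsupp_lps_scale has_bochner_integral_integral_eq[OF scaled] r_def)
  then have "ereal ?P \<le> enn2ereal (\<integral>\<^sup>+z. lps_sup_conv p s f (lps_scale p s e g) z \<partial>lebesgue)"
    by (simp add: less_eq_ennreal.rep_eq psum_nonneg)
  then have "(ereal ?P - ereal (integral\<^sup>L lebesgue f)) / ereal e \<le> lps_quotient p s f g e"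
    unfolding lps_quotient_def using \<open>0 < e\<close>
    by (intro ereal_divide_right_mono ereal_minus_mono) auto
  then show ?thesis
    using \<open>0 < e\<close> by simp
qed

text \<open>
  Here \<open>psum r A (e powr r * B)\<close> is \<open>(A\<^sup>k + e B\<^sup>k) powr r\<close> with \<open>k = 1 / r\<close>. For \<open>A > 0\<close> the difference
  quotient converges to the derivative \<open>r A\<^sup>1\<^sup>-\<^sup>k B\<^sup>k\<close> at zero. For \<open>A = 0\<close> it equals \<open>e powr (r - 1) * B\<close>, and
  its limit is zero, \<open>B\<close> or infinity according to the sign of \<open>r - 1\<close>; this matches the value of
  \<open>epow 0 (1 - 1 / r)\<close>, which is zero, one or infinity. If \<open>B = 0\<close> as well, the product on the left
  is zero even when the first factor is infinite.
\<close>

lemma tendsto_lower_bound_epow: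
  fixes A B r :: real
  assumes "0 < r" "0 \<le> A" "0 \<le> B"
    and L: "(q \<longlongrightarrow> L) (at_right 0)"
    and q: "\<forall>\<^sub>F e in at_right 0. ereal ((psum r A (e powr r * B) - A) / e) \<le> q e"
  shows "epow A (1 - 1 / r) * epow B (1 / r) \<le> ereal (1 / r) * L"
proof -
  define P where "P = (\<lambda>e. (psum r A (e powr r * B) - A) / e)"
  have le: "ereal c \<le> L" if "(P \<longlongrightarrow> c) (at_right 0)" for c
    using that q L by (intro tendsto_le[OF _ L, of "\<lambda>e. ereal (P e)"]) (auto simp: P_def)
  have scale: "ereal c \<le> ereal (1 / r) * L" if "ereal (r * c) \<le> L" for c
    using ereal_mult_left_mono[OF that, of "ereal (1 / r)"] \<open>0 < r\<close> by simp
  have B: "epow B (1 / r) = ereal (B powr (1 / r))"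
    using \<open>0 < r\<close> by (simp add: epow_def pow0_def)
  have P_nonneg: "0 \<le> P e" if "0 < e" for e
    using psum_mono[of r A A 0 "e powr r * B"] that assms by (simp add: P_def)
  have L_nonneg: "0 \<le> L"
  proof (rule tendsto_lowerbound[OF L])
    show "\<forall>\<^sub>F e in at_right 0. 0 \<le> q e"
      using q eventually_at_right_less[of 0]
    proof eventually_elim
      case (elim e)
      then show ?case
        using P_nonneg[of e] by (auto simp: P_def intro: order_trans[rotated])
    qed
  qed simp
  show ?thesis
  proof (cases "A = 0")
    case False
    then have A: "0 < A"
      using \<open>0 \<le> A\<close> by simp
    have "((\<lambda>e. ((A powr (1 / r) + e * B powr (1 / r)) powr r - (A powr (1 / r)) powr r) / e)
        \<longlongrightarrow> r * (A powr (1 / r)) powr (r - 1) * B powr (1 / r)) (at_right 0)"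
      using A by (intro tendsto_powr_quotient_at_0) simp
    moreover have "(A powr (1 / r)) powr (r - 1) = A powr (1 - 1 / r)"
      using \<open>0 < r\<close> by (simp add: powr_powr field_simps)
    moreover have "\<forall>\<^sub>F e in at_right 0.
        ((A powr (1 / r) + e * B powr (1 / r)) powr r - (A powr (1 / r)) powr r) / e = P e"
      using eventually_at_right_less[of 0]
      by eventually_elim (use \<open>0 < r\<close> A \<open>0 \<le> B\<close> in \<open>simp add: P_def psum_def powr_mult powr_powr\<close>)
    ultimately have "(P \<longlongrightarrow> r * A powr (1 - 1 / r) * B powr (1 / r)) (at_right 0)"
      by (simp cong: filterlim_cong add: tendsto_cong)
    then have "ereal (r * (A powr (1 - 1 / r) * B powr (1 / r))) \<le> L"
      by (auto dest: le simp: mult.assoc)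
    moreover have "epow A (1 - 1 / r) = ereal (A powr (1 - 1 / r))"
      using A by (simp add: epow_def pow0_def)
    ultimately show ?thesis
      using scale B by simp
  next
    case True
    have P: "P e = e powr (r - 1) * B" if "0 < e" for e
      using that True assms by (simp add: P_def powr_diff)
    show ?thesis
    proof (cases "B = 0 \<or> 1 < r")
      case True
      then have "epow A (1 - 1 / r) * epow B (1 / r) = 0"
        using \<open>A = 0\<close> B \<open>0 < r\<close> by (auto simp: epow_def pow0_def)
      moreover have "0 \<le> ereal (1 / r) * L"
        using L_nonneg \<open>0 < r\<close> by simp
      ultimately show ?thesis
        by (simp only:)
    next
      case False
      then have "0 < B" and "r \<le> 1"
        using \<open>0 \<le> B\<close> by auto
      show ?thesis
      proof (cases "r = 1")
        case True
        have "(P \<longlongrightarrow> B) (at_right 0)"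
          by (intro tendsto_eventually eventually_mono[OF eventually_at_right_less[of 0]])
            (simp add: P True)
        from le[OF this] show ?thesis
          using True \<open>0 < B\<close> by (simp add: epow_def pow0_def one_ereal_def[symmetric])
      next
        case False
        have "filterlim P at_top (at_right 0)"
          unfolding filterlim_at_top_gt[where c=0]
        proof (intro allI impI)
          fix K :: real
          assume "0 < K"
          \<comment> \<open>The solution of \<open>d powr (r - 1) * B = K\<close>.\<close>
          define d where "d = (K / B) powr (1 / (r - 1))"
          have "0 < d"
            using \<open>0 < B\<close> \<open>0 < K\<close> by (simp add: d_def)
          then have "\<forall>\<^sub>F e in at_right 0. e < d \<and> 0 < e"
            by (auto simp: eventually_at_right_less intro!: eventually_conj order_tendstoD(2)[OF tendsto_ident_at])
          then show "\<forall>\<^sub>F e in at_right 0. K \<le> P e"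
          proof eventually_elim
            case (elim e)
            have "K / B = d powr (r - 1)"
              using \<open>0 < B\<close> \<open>0 < K\<close> \<open>r \<noteq> 1\<close> by (simp add: d_def powr_powr)
            also have "\<dots> \<le> e powr (r - 1)"
              using elim \<open>r \<le> 1\<close> by (intro powr_mono2') auto
            finally show ?case
              using elim \<open>0 < B\<close> by (simp add: P pos_divide_le_eq)
          qed
        qed
        then have "((\<lambda>e. ereal (P e)) \<longlongrightarrow> \<infinity>) (at_right 0)"
          by (simp add: tendsto_PInfty_eq_at_top)
        then have "\<infinity> \<le> L"
          using q L by (intro tendsto_le[OF _ L, of "\<lambda>e. ereal (P e)"]) (auto simp: P_def)
        then show ?thesis
          using \<open>0 < r\<close> by simp
      qed
    qed
  qed
qed

section \<open>Dilates of an s-concave function\<close>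

lemma lp_coeff_sum_le:
  assumes "1 \<le> p" "0 \<le> t" "t \<le> 1" "0 \<le> l" "0 \<le> e"
  shows "lp_coeff p (1 - t) * l powr (1 / p) + lp_coeff p t * e powr (1 / p) \<le> (l + e) powr (1 / p)"
proof (cases "p = 1")
  case True
  then show ?thesis
    using assms by (simp add: lp_coeff_def pow0_def)
next
  case False
  then show ?thesis
    using holder_two_terms[of "1 / p" "1 - t" t l e] assms by (simp add: lp_coeff_def pow0_def)
qed

text \<open>
  Write \<open>G\<close> for the \<open>1/s\<close>-th power of \<open>g\<close>, and rescale the arguments to points \<open>x'\<close>, \<open>y'\<close> of the support of
  \<open>g\<close>. The competing values become \<open>a G(x') + b G(y')\<close> at \<open>a x' + b y'\<close>, with \<open>a + b \<le> c = (l + e)\<^sup>1\<^sup>/\<^sup>p\<close>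
  by Hoelder's inequality. Concavity of \<open>G\<close> bounds the value by \<open>(a + b) G(w)\<close> for the weighted mean \<open>w\<close> of
  \<open>x'\<close> and \<open>y'\<close>. Since the support contains the origin, and \<open>G(0) \<ge> 0\<close>, concavity along the segment from \<open>0\<close> to
  \<open>w\<close> replaces \<open>a + b\<close> by the larger factor \<open>c\<close>, and \<open>c G(z / c)\<close> is the \<open>1/s\<close>-th power of the dilate.
\<close>

lemma lps_sup_conv_scale_le:
  fixes g :: "'a::euclidean_space \<Rightarrow> real"
  assumes "1 \<le> p" "0 < s" "0 < l" "0 < e" and nonneg: "\<And>x. 0 \<le> g x"
    and g: "s_concave s g" and zero: "0 \<in> fsupp g"
  shows "lps_sup_conv p s (lps_scale p s l g) (lps_scale p s e g) z \<le> ennreal (lps_scale p s (l + e) g z)"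
proof (cases "z \<in> lp_sum p (fsupp (lps_scale p s l g)) (fsupp (lps_scale p s e g))")
  case False
  then show ?thesis
    by (simp add: lps_sup_conv_def)
next
  case True
  let ?G = "\<lambda>x. g x powr (1 / s)"
  have concave: "u * ?G x + v * ?G y \<le> ?G (u *\<^sub>R x + v *\<^sub>R y)"
    and convex: "u *\<^sub>R x + v *\<^sub>R y \<in> fsupp g"
    if "x \<in> fsupp g" "y \<in> fsupp g" "0 \<le> u" "0 \<le> v" "u + v = 1" for x y u v
    using g that by (auto simp: s_concave_def concave_on_iff convex_def)
  have scale_powr: "lps_scale p s l g x powr (1 / s) = l powr (1 / p) * ?G (l powr (- 1 / p) *\<^sub>R x)"
    if "0 < l" for l x
    using that nonneg \<open>0 < s\<close> by (simp add: lps_scale_def powr_mult powr_powr)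
  define c where "c = (l + e) powr (1 / p)"
  have c: "0 < c"
    using assms by (simp add: c_def)
  show ?thesis
    unfolding lps_sup_conv_def if_P[OF True]
  proof (rule Sup_least, clarify)
    fix x y and t :: real
    assume xy: "x \<in> fsupp (lps_scale p s l g)" "y \<in> fsupp (lps_scale p s e g)"
      and t: "0 \<le> t" "t \<le> 1"
    let ?z = "lp_coeff p (1 - t) *\<^sub>R x + lp_coeff p t *\<^sub>R y"
    obtain x' y' where x': "x = l powr (1 / p) *\<^sub>R x'" "x' \<in> fsupp g"
      and y': "y = e powr (1 / p) *\<^sub>R y'" "y' \<in> fsupp g"
      using xy assms by (auto simp: fsupp_lps_scale)
    have root_x: "lps_scale p s l g x powr (1 / s) = l powr (1 / p) * ?G x'"
      and root_y: "lps_scale p s e g y powr (1 / s) = e powr (1 / p) * ?G y'"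
      using assms by (simp_all add: scale_powr x' y' flip: powr_add)
    define a b where "a = lp_coeff p (1 - t) * l powr (1 / p)" and "b = lp_coeff p t * e powr (1 / p)"
    have ab: "0 \<le> a" "0 \<le> b" "a + b \<le> c"
      using assms t lp_coeff_sum_le[of p t l e] by (auto simp: a_def b_def c_def lp_coeff_nonneg)
    have "0 < a \<or> 0 < b"
      using t assms by (cases "t = 0") (auto simp: a_def b_def lp_coeff_pos)
    then have ab_pos: "0 < a + b"
      using ab by auto
    define w where "w = (a / (a + b)) *\<^sub>R x' + (b / (a + b)) *\<^sub>R y'"
    have weights: "a / (a + b) + b / (a + b) = 1"
      using ab_pos by (simp flip: add_divide_distrib)
    have w: "w \<in> fsupp g" and Gw: "a / (a + b) * ?G x' + b / (a + b) * ?G y' \<le> ?G w"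
      using convex[OF x'(2) y'(2) _ _ weights] concave[OF x'(2) y'(2) _ _ weights] ab
      by (auto simp: w_def)
    have "(a + b) / c * ?G w \<le> (a + b) / c * ?G w + (1 - (a + b) / c) * ?G 0"
      using ab c by simp
    also have "\<dots> \<le> ?G (((a + b) / c) *\<^sub>R w + (1 - (a + b) / c) *\<^sub>R 0)"
      using w zero ab c by (intro concave) auto
    also have "((a + b) / c) *\<^sub>R w + (1 - (a + b) / c) *\<^sub>R 0 = (1 / c) *\<^sub>R ?z"
      using ab_pos by (simp add: w_def x' y' a_def[symmetric] b_def[symmetric] scaleR_add_right)
    finally have Gz: "(a + b) / c * ?G w \<le> ?G ((1 / c) *\<^sub>R ?z)" .
    have "a * ?G x' + b * ?G y' = (a + b) * (a / (a + b) * ?G x' + b / (a + b) * ?G y')"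
      using ab_pos by (simp add: distrib_left)
    also have "\<dots> \<le> (a + b) * ?G w"
      using Gw ab_pos by (intro mult_left_mono) auto
    also have "\<dots> = c * ((a + b) / c * ?G w)"
      using c by simp
    also have "\<dots> \<le> c * ?G ((1 / c) *\<^sub>R ?z)"
      using Gz c by (intro mult_left_mono) auto
    also have "\<dots> = lps_scale p s (l + e) g ?z powr (1 / s)"
      using assms by (simp add: scale_powr c_def powr_minus_divide)
    finally have "a * ?G x' + b * ?G y' \<le> lps_scale p s (l + e) g ?z powr (1 / s)" .
    then have "(a * ?G x' + b * ?G y') powr s \<le> (lps_scale p s (l + e) g ?z powr (1 / s)) powr s"
      using ab \<open>0 < s\<close> by (intro powr_mono2) auto
    also have "\<dots> = lps_scale p s (l + e) g ?z"
      using \<open>0 < s\<close> lps_scale_nonneg[of g p s "l + e" ?z] nonneg by (simp add: powr_powr)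
    also have "a * ?G x' + b * ?G y' = lp_coeff p (1 - t) * lps_scale p s l g x powr (1 / s)
        + lp_coeff p t * lps_scale p s e g y powr (1 / s)"
      by (simp add: root_x root_y a_def b_def mult.assoc)
    finally show "ennreal ((lp_coeff p (1 - t) * lps_scale p s l g x powr (1 / s)
        + lp_coeff p t * lps_scale p s e g y powr (1 / s)) powr s) \<le> ennreal (lps_scale p s (l + e) g ?z)"
      by (rule ennreal_leI)
  qed
qed

lemma lps_quotient_scale_le:
  fixes g :: "real^'n \<Rightarrow> real"
  assumes "1 \<le> p" "0 < s" "0 < l" "0 < e" and nonneg: "\<And>x. 0 \<le> g x"
    and int: "integrable lebesgue g"
    and g: "s_concave s g" and zero: "0 \<in> fsupp g"
  defines "r \<equiv> (real CARD('n) + s) / p"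
  shows "lps_quotient p s (lps_scale p s l g) g e
    \<le> ereal (((l + e) powr r - l powr r) / e * integral\<^sup>L lebesgue g)"
proof -
  let ?B = "integral\<^sup>L lebesgue g"
  have hb: "has_bochner_integral lebesgue (lps_scale p s k g) (k powr r * ?B)" if "0 < k" for k
    using has_bochner_integral_lps_scale[OF that int nonneg, of p s] by (simp add: r_def)
  have "(\<integral>\<^sup>+z. lps_sup_conv p s (lps_scale p s l g) (lps_scale p s e g) z \<partial>lebesgue)
      \<le> (\<integral>\<^sup>+z. ennreal (lps_scale p s (l + e) g z) \<partial>lebesgue)"
    using assms by (intro nn_integral_mono lps_sup_conv_scale_le) auto
  also have "\<dots> = ennreal ((l + e) powr r * ?B)"
    using hb[of "l + e"] assms
    by (subst nn_integral_eq_integral) (auto simp: lps_scale_nonneg has_bochner_integral_iff)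
  finally have "enn2ereal (\<integral>\<^sup>+z. lps_sup_conv p s (lps_scale p s l g) (lps_scale p s e g) z \<partial>lebesgue)
      \<le> ereal ((l + e) powr r * ?B)"
    using nonneg by (simp add: less_eq_ennreal.rep_eq)
  then have "lps_quotient p s (lps_scale p s l g) g e
      \<le> (ereal ((l + e) powr r * ?B) - ereal (l powr r * ?B)) / ereal e"
    unfolding lps_quotient_def has_bochner_integral_integral_eq[OF hb[OF \<open>0 < l\<close>]] using \<open>0 < e\<close>
    by (intro ereal_divide_right_mono ereal_minus_mono) auto
  then show ?thesis
    using \<open>0 < e\<close> by (simp add: left_diff_distrib diff_divide_distrib)
qed

lemma S_tilde_scale_le:
  fixes g :: "real^'n \<Rightarrow> real"
  assumes "1 \<le> p" "0 < s" "0 < l" and nonneg: "\<And>x. 0 \<le> g x"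
    and int: "integrable lebesgue g"
    and g: "s_concave s g" and zero: "0 \<in> fsupp g"
    and L: "(lps_quotient p s (lps_scale p s l g) g \<longlongrightarrow> L) (at_right 0)"
  defines "r \<equiv> (real CARD('n) + s) / p"
  shows "ereal (1 / r) * L \<le> epow (integral\<^sup>L lebesgue (lps_scale p s l g)) (1 - 1 / r)
    * epow (integral\<^sup>L lebesgue g) (1 / r)"
proof -
  define B where "B = integral\<^sup>L lebesgue g"
  have r: "0 < r"
    using assms by (simp add: r_def add_nonneg_pos)
  have B: "0 \<le> B"
    using nonneg by (simp add: B_def)
  have "((\<lambda>e. ((l + e * 1) powr r - l powr r) / e * B) \<longlongrightarrow> r * l powr (r - 1) * 1 * B) (at_right 0)"
    using \<open>0 < l\<close> by (intro tendsto_mult_right tendsto_powr_quotient_at_0)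
  then have "((\<lambda>e. ereal (((l + e) powr r - l powr r) / e * B)) \<longlongrightarrow> ereal (r * l powr (r - 1) * B)) (at_right 0)"
    by simp
  moreover have "\<forall>\<^sub>F e in at_right 0. lps_quotient p s (lps_scale p s l g) g e
      \<le> ereal (((l + e) powr r - l powr r) / e * B)"
    using eventually_at_right_less[of 0]
    by eventually_elim (unfold r_def B_def, rule lps_quotient_scale_le, use assms in auto)
  ultimately have "L \<le> ereal (r * l powr (r - 1) * B)"
    by (intro tendsto_le[OF _ _ L]) auto
  then have "ereal (1 / r) * L \<le> ereal (1 / r) * ereal (r * l powr (r - 1) * B)"
    using r by (intro ereal_mult_left_mono) auto
  also have "\<dots> = ereal (l powr (r - 1) * B)"
    using r by simp
  also have "\<dots> = epow (l powr r * B) (1 - 1 / r) * epow B (1 / r)"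
  proof (cases "B = 0")
    case True
    then show ?thesis
      using r by (simp add: epow_def pow0_def)
  next
    case False
    have "(l powr r * B) powr (1 - 1 / r) * B powr (1 / r)
        = (l powr r) powr (1 - 1 / r) * (B powr (1 - 1 / r) * B powr (1 / r))"
      using B by (simp add: powr_mult)
    also have "(l powr r) powr (1 - 1 / r) = l powr (r - 1)"
      using r by (simp add: powr_powr right_diff_distrib)
    also have "B powr (1 - 1 / r) * B powr (1 / r) = B"
      using False B by (simp flip: powr_add)
    finally show ?thesis
      using False B r \<open>0 < l\<close> by (simp add: epow_def pow0_def)
  qed
  finally show ?thesis
    using has_bochner_integral_integral_eq[OF has_bochner_integral_lps_scale[OF \<open>0 < l\<close> int nonneg]]
    by (simp add: B_def r_def)
qed

theorem corollary4p1:
  fixes f g :: "real^'n \<Rightarrow> real" and p s :: real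
  assumes "p \<ge> 1" and "s > 0"
    and "\<And>x. f x \<ge> 0" and "\<And>x. g x \<ge> 0"
    and "integrable lebesgue f" and "integrable lebesgue g"
    and "fsupp f \<noteq> {}" and "fsupp g \<noteq> {}"
    and "S_tilde_exists p s f g"
  shows "S_tilde p s f g \<ge>
           epow (integral\<^sup>L lebesgue f) (1 - p / (real CARD('n) + s)) *
           epow (integral\<^sup>L lebesgue g) (p / (real CARD('n) + s)) \<and>
         (s \<in> \<int> \<and> (\<exists>l>0. f = lps_scale p s l g) \<and> s_concave s g \<and>
            interior (fsupp g) \<noteq> {} \<and> 0 \<in> fsupp g \<longrightarrow>
          S_tilde p s f g =
            epow (integral\<^sup>L lebesgue f) (1 - p / (real CARD('n) + s)) *
            epow (integral\<^sup>L lebesgue g) (p / (real CARD('n) + s)))"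
proof -
  let ?r = "(real CARD('n) + s) / p"
  have r: "0 < ?r"
    using assms(1,2) by (simp add: add_nonneg_pos)
  have meas: "\<forall>\<^sub>F e in at_right 0. lps_sup_conv p s f (lps_scale p s e g) \<in> borel_measurable lebesgue"
    using assms(9) by (simp add: S_tilde_exists_def)
  obtain L where L: "(lps_quotient p s f g \<longlongrightarrow> L) (at_right 0)"
    using assms(9) by (auto simp: S_tilde_exists_def)
  have S: "S_tilde p s f g = ereal (1 / ?r) * L"
    using tendsto_Lim[OF _ L] by (simp add: S_tilde_def)
  have "\<forall>\<^sub>F e in at_right 0. ereal ((psum ?r (integral\<^sup>L lebesgue f) (e powr ?r * integral\<^sup>L lebesgue g)
      - integral\<^sup>L lebesgue f) / e) \<le> lps_quotient p s f g e"
    using meas eventually_at_right_less[of 0]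
    by eventually_elim (rule lps_quotient_ge, use assms in auto)
  then have ge: "epow (integral\<^sup>L lebesgue f) (1 - 1 / ?r) * epow (integral\<^sup>L lebesgue g) (1 / ?r)
      \<le> S_tilde p s f g"
    unfolding S using assms(3,4) r L by (intro tendsto_lower_bound_epow) auto
  moreover have "S_tilde p s f g
      \<le> epow (integral\<^sup>L lebesgue f) (1 - 1 / ?r) * epow (integral\<^sup>L lebesgue g) (1 / ?r)"
    if "0 < l" "f = lps_scale p s l g" "s_concave s g" "0 \<in> fsupp g" for l
    using S_tilde_scale_le[OF assms(1,2) that(1) assms(4,6) that(3,4)] L S that(2) by simp
  ultimately show ?thesis
    by (auto intro: antisym)
qed

end
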